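(* Let $x=(x_1,x_2,\ldots)$ and $y=(y_1,y_2,\ldots)$ be two sequences of indeterminates and let $h\ge 1$ be an integer. Let $K_h(x)=(K_h(x)_{rs})_{0\le r,s\le h}$ be the $(h+1)\times(h+1)$ antisymmetric matrix with entries $$K_h(x)_{rs}=\begin{cases}0, & r=s=0,\\ -\tfrac{1}{\sqrt2}\,q_s(x), & r=0,\ s\ge1,\\ \tfrac1{\sqrt2}\,q_r(x), & r\ge1,\ s=0,\\ \tfrac12\,Q_{(r,s)}(x), & r\ge1,\ s\ge1,\end{cases}$$ and let $K_h(y)$ be the same matrix with $x$ replaced by $y$. Then $$\sum_{\lambda\in\mathcal{D},\ \lambda_1\le h}Q_\lambda(x)\,P_\lambda(y)=\Big(\det\big(I-K_h(x)\,K_h(y)\big)\Big)^{1/2},$$ where the square root is the one with constant term $1$ as a formal power series in $x,y$.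
   Context: A strict partition is a partition $\lambda=(\lambda_1>\lambda_2>\cdots>\lambda_\ell>0)$ into distinct positive parts; $\ell(\lambda)=\ell$ is its length, and the empty partition (with $\lambda_1=0$) is included. $\mathcal{D}$ denotes the set of all strict partitions. The shifted shape of $\lambda\in\mathcal{D}$ is obtained from the usual Young diagram of $\lambda$ by indenting the $i$-th row to the right by $i-1$ boxes. Let $\mathbb{P}=\{1',1,2',2,3',3,\ldots\}$ with the order $1'<1<2'<2<3'<3<\cdots$. A (generalized) shifted Young tableau $T$ of shape $\lambda$ is a filling of the boxes of the shifted shape of $\lambda$ by elements of $\mathbb{P}$ which is weakly increasing across rows and down columns, and such that for each positive integer $k$ there is at most one $k'$ in each row and at most one (unmarked) $k$ in each column. Put $x^T=x_1^{a_1}x_2^{a_2}\cdots$, where $a_k$ is the total number of entries of $T$ equal to $k$ or $k'$. The Schur $Q$-function and $P$-function are $$Q_\lambda(x)=\sum_T x^T,\qquad P_\lambda(x)=2^{-\ell(\lambda)}Q_\lambda(x),$$ the sum being over all shifted Young tableaux $T$ of shape $\lambda$. The symmetric functions $q_k(x)$ are defined by $$\prod_{i\ge1}\frac{1+t x_i}{1-t x_i}=\sum_{k\ge0}q_k(x)\,t^k .$$ For integers $r>s\ge0$, $$Q_{(r,s)}(x)=q_r(x)q_s(x)+2\sum_{i=1}^s(-1)^i q_{r+i}(x)\,q_{s-i}(x),$$ and for $r\le s$ one sets $Q_{(r,s)}=-Q_{(s,r)}$ (so $Q_{(r,r)}=0$). For a strict partition $\lambda$, written as $\lambda_1>\cdots>\lambda_{2k}\ge0$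 by appending a part $0$ if the number of parts is odd, the Schur $Q$-function also equals the Pfaffian of the antisymmetric matrix $(Q_{(\lambda_i,\lambda_j)})_{1\le i,j\le 2k}$ (a classical fact). *)

theory Defs
  imports
    "HOL-Library.Multiset"
    "HOL-Library.FuncSet"
    "HOL-Computational_Algebra.Formal_Power_Series"
    "Jordan_Normal_Form.Determinant"
begin

section \<open>Formal power series in arbitrarily many commuting indeterminates\<close>

text \<open>
  A monomial in the indeterminates \<open>'v\<close> is a finite multiset over \<open>'v\<close>, and a real formal power
  series is an arbitrary family of coefficients indexed by the monomials.
\<close>

typedef 'v mps = "UNIV :: ('v multiset \<Rightarrow> real) set"
  morphisms mps_coeff Abs_mps ..

setup_lifting type_definition_mps

lemma mps_eqI: "(\<And>m. mps_coeff f m = mps_coeff g m) \<Longrightarrow> f = g"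
  by transfer auto

lemma mps_coeff_Abs_mps [simp]: "mps_coeff (Abs_mps c) m = c m"
  by (simp add: Abs_mps_inverse)

lemma finite_submultisets: "finite {a. a \<subseteq># m}"
proof (induction m)
  case (add x m)
  have "{a. a \<subseteq># add_mset x m} \<subseteq> {a. a \<subseteq># m} \<union> add_mset x ` {a. a \<subseteq># m}"
  proof
    fix a assume a: "a \<in> {a. a \<subseteq># add_mset x m}"
    show "a \<in> {a. a \<subseteq># m} \<union> add_mset x ` {a. a \<subseteq># m}"
    proof (cases "x \<in># a")
      case True
      then obtain b where "a = add_mset x b" by (meson multi_member_split)
      with a show ?thesis by auto
    next
      case False
      with a have "a \<subseteq># m"
        by (auto simp: subseteq_mset_def not_in_iff) (metis le0)
      then show ?thesis by auto
    qed
  qed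
  then show ?case using add by (meson finite_UnI finite_imageI finite_subset)
qed auto

definition splits :: "'v multiset \<Rightarrow> ('v multiset \<times> 'v multiset) set" where
  "splits m = {(a, b). a + b = m}"

lemma splits_eq_image: "splits m = (\<lambda>a. (a, m - a)) ` {a. a \<subseteq># m}"
  by (auto simp: splits_def image_iff)

lemma finite_splits [simp, intro]: "finite (splits m)"
  unfolding splits_eq_image by (intro finite_imageI finite_submultisets)

instantiation mps :: (type) comm_ring_1
begin

lift_definition zero_mps :: "'v mps" is "\<lambda>m. 0" .
lift_definition one_mps :: "'v mps" is "\<lambda>m. if m = {#} then 1 else 0" .
lift_definition plus_mps :: "'v mps \<Rightarrow> 'v mps \<Rightarrow> 'v mps" is "\<lambda>f g m. f m + g m" .
lift_definition minus_mps :: "'v mps \<Rightarrow> 'v mps \<Rightarrow> 'v mps" is "\<lambda>f g m. f m - g m" .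
lift_definition uminus_mps :: "'v mps \<Rightarrow> 'v mps" is "\<lambda>f m. - f m" .
lift_definition times_mps :: "'v mps \<Rightarrow> 'v mps \<Rightarrow> 'v mps"
  is "\<lambda>f g m. \<Sum>(a, b)\<in>splits m. f a * g b" .

instance
proof
  fix f g h :: "'a mps"
  show "f * g * h = f * (g * h)"
  proof (transfer, rule ext)
    fix f g h :: "'a multiset \<Rightarrow> real" and m
    have "(\<Sum>(a, b)\<in>splits m. (\<Sum>(c, d)\<in>splits a. f c * g d) * h b)
        = (\<Sum>p\<in>splits m. \<Sum>q\<in>splits (fst p). f (fst q) * g (snd q) * h (snd p))"
      by (simp add: sum_distrib_right case_prod_unfold)
    also have "\<dots> = (\<Sum>z\<in>Sigma (splits m) (\<lambda>p. splits (fst p)).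
        f (fst (snd z)) * g (snd (snd z)) * h (snd (fst z)))"
      by (subst sum.Sigma) (auto simp: case_prod_unfold)
    also have "\<dots> = (\<Sum>z\<in>Sigma (splits m) (\<lambda>p. splits (snd p)).
        f (fst (fst z)) * g (fst (snd z)) * h (snd (snd z)))"
      by (rule sum.reindex_bij_witness
            [where i = "\<lambda>z. ((fst (fst z) + fst (snd z), snd (snd z)), (fst (fst z), fst (snd z)))"
               and j = "\<lambda>z. ((fst (snd z), snd (snd z) + snd (fst z)), (snd (snd z), snd (fst z)))"])
         (auto simp: splits_def add.assoc)
    also have "\<dots> = (\<Sum>p\<in>splits m. \<Sum>q\<in>splits (snd p). f (fst p) * g (fst q) * h (snd q))"
      by (subst sum.Sigma) (auto simp: case_prod_unfold)
    also have "\<dots> = (\<Sum>(a, b)\<in>splits m. f a * (\<Sum>(c, d)\<in>splits b. g c * h d))"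
      by (simp add: sum_distrib_left case_prod_unfold mult.assoc)
    finally show "(\<Sum>(a, b)\<in>splits m. (\<Sum>(c, d)\<in>splits a. f c * g d) * h b)
      = (\<Sum>(a, b)\<in>splits m. f a * (\<Sum>(c, d)\<in>splits b. g c * h d))" .
  qed
  show "f * g = g * f"
  proof (transfer, rule ext)
    fix f g :: "'a multiset \<Rightarrow> real" and m
    show "(\<Sum>(a, b)\<in>splits m. f a * g b) = (\<Sum>(a, b)\<in>splits m. g a * f b)"
      by (rule sum.reindex_bij_witness[where i = prod.swap and j = prod.swap])
         (auto simp: splits_def add.commute)
  qed
  show "1 * f = f"
  proof (transfer, rule ext)
    fix f :: "'a multiset \<Rightarrow> real" and m
    have "(\<Sum>(a, b)\<in>splits m. (if a = {#} then 1 else 0) * f b)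
        = (\<Sum>(a, b)\<in>{({#} :: 'a multiset, m)}. (if a = {#} then 1 else 0) * f b)"
      by (rule sum.mono_neutral_right[OF finite_splits]) (auto simp: splits_def split: if_splits)
    then show "(\<Sum>(a, b)\<in>splits m. (if a = {#} then 1 else 0) * f b) = f m" by simp
  qed
  show "(f + g) * h = f * h + g * h"
    by (transfer, rule ext)
       (simp add: case_prod_unfold distrib_right sum.distrib)
  show "(0 :: 'a mps) \<noteq> 1"
    by transfer (metis zero_neq_one)
qed (transfer; auto)+

end

lemma mps_coeff_arith [simp]:
  "mps_coeff 0 m = 0"
  "mps_coeff 1 m = (if m = {#} then 1 else 0)"
  "mps_coeff (f + g) m = mps_coeff f m + mps_coeff g m"
  "mps_coeff (f - g) m = mps_coeff f m - mps_coeff g m"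
  "mps_coeff (- f) m = - mps_coeff f m"
  by (transfer; simp)+

lemma mps_coeff_mult:
  "mps_coeff (f * g) m = (\<Sum>(a, b)\<in>splits m. mps_coeff f a * mps_coeff g b)"
  by transfer simp

lemma mps_coeff_sum [simp]: "mps_coeff (sum f A) m = (\<Sum>a\<in>A. mps_coeff (f a) m)"
  by (induction A rule: infinite_finite_induct) auto

definition mps_const :: "real \<Rightarrow> 'v mps" where
  "mps_const c = Abs_mps (\<lambda>m. if m = {#} then c else 0)"

definition mps_var :: "'v \<Rightarrow> 'v mps" where
  "mps_var v = Abs_mps (\<lambda>m. if m = {#v#} then 1 else 0)"

text \<open>The square root with constant term 1; see \<open>mps_sqrt_ex1\<close> for its existence and uniqueness.\<close>

definition mps_sqrt :: "'v mps \<Rightarrow> 'v mps" where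
  "mps_sqrt f = (THE g. g ^ 2 = f \<and> mps_coeff g {#} = 1)"

lemma mps_coeff_square:
  assumes "m \<noteq> {#}"
  shows "mps_coeff (g ^ 2) m = 2 * mps_coeff g {#} * mps_coeff g m
    + (\<Sum>a | a \<subset># m \<and> a \<noteq> {#}. mps_coeff g a * mps_coeff g (m - a))"
proof -
  have eq: "{a. a \<subseteq># m} = insert {#} (insert m {a. a \<subset># m \<and> a \<noteq> {#}})"
    by (auto simp: subset_mset.less_le)
  have fin: "finite {a. a \<subset># m \<and> a \<noteq> {#}}"
    by (rule finite_subset[OF _ finite_submultisets[of m]]) (auto simp: subset_mset.less_le)
  have "mps_coeff (g ^ 2) m = (\<Sum>a | a \<subseteq># m. mps_coeff g a * mps_coeff g (m - a))"
    unfolding power2_eq_square mps_coeff_mult splits_eq_image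
    by (subst sum.reindex) (auto simp: inj_on_def)
  then show ?thesis
    unfolding eq using fin assms by simp
qed

function sqrt_coeff :: "('v multiset \<Rightarrow> real) \<Rightarrow> 'v multiset \<Rightarrow> real" where
  "sqrt_coeff f m = (if m = {#} then 1 else
     (f m - (\<Sum>a | a \<subset># m \<and> a \<noteq> {#}. sqrt_coeff f a * sqrt_coeff f (m - a))) / 2)"
  by auto
termination
proof (relation "Wellfounded.measure (\<lambda>(f, m). size m)", goal_cases)
  case (3 f m a)
  then have "a \<subseteq># m" "size a > 0" by (auto simp: subset_mset.less_le nonempty_has_size)
  then show ?case
    using size_Diff_submset[of a m] size_mset_mono[of a m] by simp
qed (auto simp: mset_subset_size)

declare sqrt_coeff.simps [simp del]

theorem mps_sqrt_ex1:
  assumes "mps_coeff f {#} = 1"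
  shows "\<exists>!g. g ^ 2 = f \<and> mps_coeff g {#} = 1"
proof (rule ex_ex1I)
  define g where "g = Abs_mps (sqrt_coeff (mps_coeff f))"
  have g0: "mps_coeff g {#} = 1"
    by (simp add: g_def sqrt_coeff.simps)
  have "mps_coeff (g ^ 2) m = mps_coeff f m" for m
  proof (cases "m = {#}")
    case True
    then show ?thesis
      using assms g0 by (simp add: power2_eq_square mps_coeff_mult splits_def)
  next
    case False
    then show ?thesis
      using mps_coeff_square[OF False, of g] g0
      by (simp add: g_def sqrt_coeff.simps[of _ m])
  qed
  then show "\<exists>g. g ^ 2 = f \<and> mps_coeff g {#} = 1"
    using g0 mps_eqI by blast
next
  fix g h :: "'a mps"
  assume g: "g ^ 2 = f \<and> mps_coeff g {#} = 1" and h: "h ^ 2 = f \<and> mps_coeff h {#} = 1"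
  have "mps_coeff g m = mps_coeff h m" for m
  proof (induction "size m" arbitrary: m rule: less_induct)
    case less
    show ?case
    proof (cases "m = {#}")
      case False
      have "(\<Sum>a | a \<subset># m \<and> a \<noteq> {#}. mps_coeff g a * mps_coeff g (m - a))
          = (\<Sum>a | a \<subset># m \<and> a \<noteq> {#}. mps_coeff h a * mps_coeff h (m - a))"
      proof (rule sum.cong, goal_cases)
        case (2 a)
        then have "a \<subseteq># m" "size a > 0" "size a < size m"
          by (auto simp: subset_mset.less_le nonempty_has_size mset_subset_size)
        then have "size (m - a) < size m"
          by (simp add: size_Diff_submset)
        then show ?case using less \<open>size a < size m\<close> by simp
      qed simp
      then show ?thesis
        using mps_coeff_square[OF False, of g] mps_coeff_square[OF False, of h] g h by simp
    qed (use g h in simp)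
  qed
  then show "g = h" by (rule mps_eqI)
qed

lemma mps_sqrtI: "g ^ 2 = f \<Longrightarrow> mps_coeff g {#} = 1 \<Longrightarrow> mps_sqrt f = g"
proof -
  assume g: "g ^ 2 = f" "mps_coeff g {#} = 1"
  then have "mps_coeff f {#} = 1"
    by (auto simp: power2_eq_square mps_coeff_mult splits_def)
  from mps_sqrt_ex1[OF this] g show "mps_sqrt f = g"
    unfolding mps_sqrt_def by (intro the1_equality) auto
qed


section \<open>Strict partitions and shifted Young tableaux\<close>

definition strict_partition :: "nat list \<Rightarrow> bool" where
  "strict_partition l \<longleftrightarrow> sorted_wrt (>) l \<and> (\<forall>p\<in>set l. p > 0)"

definition largest_part :: "nat list \<Rightarrow> nat" where
  "largest_part l = (case l of [] \<Rightarrow> 0 | p # _ \<Rightarrow> p)"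

lemma finite_strict_partitions: "finite {l. strict_partition l \<and> largest_part l \<le> h}"
proof (rule finite_subset)
  show "{l. strict_partition l \<and> largest_part l \<le> h} \<subseteq> {l. set l \<subseteq> {..h} \<and> distinct l}"
  proof safe
    fix l p assume "strict_partition l" "largest_part l \<le> h" "p \<in> set l"
    then show "p \<le> h"
      by (cases l) (auto simp: strict_partition_def largest_part_def)
  next
    fix l assume "strict_partition l"
    then show "distinct l"
      by (induction l) (auto simp: strict_partition_def)
  qed
  show "finite {l. set l \<subseteq> {..h} \<and> distinct l}"
    by (rule finite_subset_distinct) simp
qed

text \<open>Boxes are (row, column) pairs, both counted from 0.\<close>

definition shifted_shape :: "nat list \<Rightarrow> (nat \<times> nat) set" where
  "shifted_shape l = {(i, j). i < length l \<and> i \<le> j \<and> j < i + l ! i}"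

lemma finite_shifted_shape [simp, intro]: "finite (shifted_shape l)"
proof (rule finite_subset)
  show "shifted_shape l \<subseteq> (SIGMA i:{..<length l}. {..<i + l ! i})"
    by (auto simp: shifted_shape_def)
qed auto

text \<open>
  The alphabet \<open>1' < 1 < 2' < 2 < \<dots>\<close>.  Like the indeterminates, the letters are indexed by all
  natural numbers: \<open>Marked k\<close> and \<open>Unmarked k\<close> are the letters usually written with \<open>k + 1\<close>.
\<close>

datatype letter = Marked (letter_index: nat) | Unmarked (letter_index: nat)

fun letter_rank :: "letter \<Rightarrow> nat" where
  "letter_rank (Marked k) = 2 * k"
| "letter_rank (Unmarked k) = 2 * k + 1"

lemma letter_rank_inject: "letter_rank a = letter_rank b \<Longrightarrow> a = b"
  by (cases a; cases b; simp; presburger)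

instantiation letter :: linorder
begin

definition less_eq_letter :: "letter \<Rightarrow> letter \<Rightarrow> bool" where
  "a \<le> b \<longleftrightarrow> letter_rank a \<le> letter_rank b"

definition less_letter :: "letter \<Rightarrow> letter \<Rightarrow> bool" where
  "a < b \<longleftrightarrow> letter_rank a < letter_rank b"

instance
  by standard (auto simp: less_eq_letter_def less_letter_def letter_rank_inject)

end

text \<open>
  Fillings are extensional functions, that is, equal to \<open>undefined\<close> outside the shape, so that
  distinct tableaux are distinct functions.
\<close>

definition shifted_tableaux :: "nat list \<Rightarrow> (nat \<times> nat \<Rightarrow> letter) set" where
  "shifted_tableaux l = {T \<in> shifted_shape l \<rightarrow>\<^sub>E UNIV.
     (\<forall>i j j'. (i, j) \<in> shifted_shape l \<longrightarrow> (i, j') \<in> shifted_shape l \<longrightarrow> j \<le> j' \<longrightarrow>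
        T (i, j) \<le> T (i, j')) \<and>
     (\<forall>i i' j. (i, j) \<in> shifted_shape l \<longrightarrow> (i', j) \<in> shifted_shape l \<longrightarrow> i \<le> i' \<longrightarrow>
        T (i, j) \<le> T (i', j)) \<and>
     (\<forall>k i j j'. (i, j) \<in> shifted_shape l \<longrightarrow> (i, j') \<in> shifted_shape l \<longrightarrow>
        T (i, j) = Marked k \<longrightarrow> T (i, j') = Marked k \<longrightarrow> j = j') \<and>
     (\<forall>k i i' j. (i, j) \<in> shifted_shape l \<longrightarrow> (i', j) \<in> shifted_shape l \<longrightarrow>
        T (i, j) = Unmarked k \<longrightarrow> T (i', j) = Unmarked k \<longrightarrow> i = i')}"

text \<open>
  The monomial of a tableau, for the sequence of indeterminates \<open>x 0, x 1, \<dots>\<close>: each box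
  contributes the indeterminate indexed by its entry, regardless of the mark.
\<close>

definition tableau_monomial :: "(nat \<Rightarrow> 'v) \<Rightarrow> nat list \<Rightarrow> (nat \<times> nat \<Rightarrow> letter) \<Rightarrow> 'v multiset" where
  "tableau_monomial x l T = image_mset (\<lambda>b. x (letter_index (T b))) (mset_set (shifted_shape l))"

lemma finite_tableaux_with_monomial:
  assumes "inj x"
  shows "finite {T \<in> shifted_tableaux l. tableau_monomial x l T = m}"
proof (rule finite_subset)
  let ?L = "(Marked ` (x -` set_mset m)) \<union> (Unmarked ` (x -` set_mset m))"
  show "{T \<in> shifted_tableaux l. tableau_monomial x l T = m} \<subseteq> shifted_shape l \<rightarrow>\<^sub>E ?L"
  proof
    fix T assume T: "T \<in> {T \<in> shifted_tableaux l. tableau_monomial x l T = m}"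
    have "T b \<in> ?L" if "b \<in> shifted_shape l" for b
    proof -
      have "x (letter_index (T b)) \<in># m"
        using T that by (auto simp: tableau_monomial_def)
      then show ?thesis by (cases "T b") auto
    qed
    then show "T \<in> shifted_shape l \<rightarrow>\<^sub>E ?L"
      using T by (auto simp: shifted_tableaux_def PiE_iff)
  qed
  show "finite (shifted_shape l \<rightarrow>\<^sub>E ?L)"
    using assms by (intro finite_PiE) (auto intro: finite_vimageI)
qed


section \<open>Schur Q- and P-functions\<close>

text \<open>
  The coefficient of a monomial in the formal sum of the tableau monomials is the number of tableaux
  having that monomial, which is finite for distinct indeterminates by
  \<open>finite_tableaux_with_monomial\<close>.
\<close>

definition schur_Q :: "(nat \<Rightarrow> 'v) \<Rightarrow> nat list \<Rightarrow> 'v mps" where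
  "schur_Q x l = Abs_mps (\<lambda>m. real (card {T \<in> shifted_tableaux l. tableau_monomial x l T = m}))"

definition schur_P :: "(nat \<Rightarrow> 'v) \<Rightarrow> nat list \<Rightarrow> 'v mps" where
  "schur_P x l = mps_const (1 / 2 ^ length l) * schur_Q x l"

text \<open>The quotient \<open>(1 + t v) / (1 - t v)\<close> as a power series in \<open>t\<close>; see \<open>q_factor_correct\<close>.\<close>

definition q_factor :: "'v \<Rightarrow> 'v mps fps" where
  "q_factor v = (1 + fps_X * fps_const (mps_var v)) * Abs_fps (\<lambda>k. mps_var v ^ k)"

lemma q_factor_nth: "fps_nth (q_factor v) k = (if k = 0 then 1 else 2 * mps_var v ^ k)"
  by (cases k) (auto simp: q_factor_def distrib_right mult.assoc)

lemma q_factor_correct: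
  "q_factor v * (1 - fps_X * fps_const (mps_var v)) = 1 + fps_X * fps_const (mps_var v)"
proof -
  have "Abs_fps (\<lambda>k. mps_var v ^ k) * (1 - fps_X * fps_const (mps_var v)) = 1"
  proof (rule fps_ext)
    fix n
    show "fps_nth (Abs_fps (\<lambda>k. mps_var v ^ k) * (1 - fps_X * fps_const (mps_var v))) n
        = fps_nth 1 n"
      by (cases n) (auto simp: algebra_simps)
  qed
  then show ?thesis by (simp add: q_factor_def mult.assoc)
qed

text \<open>
  The infinite product is taken in the sense of convergence of every coefficient; the coefficients
  of the finite products are eventually constant by \<open>eventually_schur_q_coeff\<close>.
\<close>

definition schur_q :: "(nat \<Rightarrow> 'v) \<Rightarrow> nat \<Rightarrow> 'v mps" where
  "schur_q x k = Abs_mps (\<lambda>m. lim (\<lambda>n. mps_coeff (fps_nth (\<Prod>i<n. q_factor (x i)) k) m))"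

lemma mps_coeff_var_mult_eq_0:
  assumes "v \<notin># m"
  shows "mps_coeff (f * mps_var v ^ Suc k) m = 0"
proof -
  have "mps_coeff (mps_var v * h) m = 0" for h :: "'a mps"
    unfolding mps_coeff_mult
    by (rule sum.neutral) (use assms in \<open>auto simp: splits_def mps_var_def\<close>)
  from this[of "f * mps_var v ^ k"] show ?thesis by (simp add: ac_simps)
qed

lemma eventually_schur_q_coeff:
  assumes "inj x"
  shows "eventually (\<lambda>n. mps_coeff (fps_nth (\<Prod>i<n. q_factor (x i)) k) m
           = mps_coeff (schur_q x k) m) sequentially"
proof -
  let ?c = "\<lambda>n. mps_coeff (fps_nth (\<Prod>i<n. q_factor (x i)) k) m"
  have "finite (x -` set_mset m)" using assms by (intro finite_vimageI) auto
  then obtain N where N: "\<And>i. x i \<in># m \<Longrightarrow> i < N"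
    by (metis finite_nat_bounded lessThan_iff subsetD vimageI)
  have step: "?c (Suc n) = ?c n" if "n \<ge> N" for n
  proof -
    let ?F = "\<Prod>i<n. q_factor (x i)"
    have xn: "x n \<notin># m" using N that by (meson leD)
    have "?c (Suc n) = (\<Sum>i=0..k. mps_coeff (fps_nth ?F i * fps_nth (q_factor (x n)) (k - i)) m)"
      by (simp add: fps_mult_nth)
    also have "\<dots> = (\<Sum>i\<in>{k}. mps_coeff (fps_nth ?F i * fps_nth (q_factor (x n)) (k - i)) m)"
    proof (rule sum.mono_neutral_right)
      show "\<forall>i\<in>{0..k} - {k}. mps_coeff (fps_nth ?F i * fps_nth (q_factor (x n)) (k - i)) m = 0"
      proof
        fix i assume "i \<in> {0..k} - {k}"
        then have "i < k" by auto
        then obtain d where d: "k - i = Suc d" by (metis Suc_diff_Suc)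
        show "mps_coeff (fps_nth ?F i * fps_nth (q_factor (x n)) (k - i)) m = 0"
          using mps_coeff_var_mult_eq_0[OF xn, of "fps_nth ?F i * 2" d]
          by (simp only: d q_factor_nth mult.assoc) simp
      qed
    qed auto
    also have "\<dots> = ?c n" by (simp add: q_factor_nth)
    finally show ?thesis .
  qed
  have const: "?c n = ?c N" if "n \<ge> N" for n
    using that by (induction n rule: dec_induct) (simp_all only: step)
  then have ev: "eventually (\<lambda>n. ?c n = ?c N) sequentially"
    unfolding eventually_sequentially by blast
  then have "?c \<longlonglongrightarrow> ?c N"
    by (rule tendsto_eventually)
  then have "mps_coeff (schur_q x k) m = ?c N"
    by (simp add: schur_q_def limI)
  then show ?thesis
    using ev by simp
qed

definition two_row_Q :: "(nat \<Rightarrow> 'v) \<Rightarrow> nat \<Rightarrow> nat \<Rightarrow> 'v mps" where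
  "two_row_Q x r s =
     (let Q = (\<lambda>r s. schur_q x r * schur_q x s
                + 2 * (\<Sum>i=1..s. (-1) ^ i * schur_q x (r + i) * schur_q x (s - i)))
      in if r > s then Q r s else if r < s then - Q s r else 0)"

definition K_mat :: "nat \<Rightarrow> (nat \<Rightarrow> 'v) \<Rightarrow> 'v mps mat" where
  "K_mat h x = mat (h + 1) (h + 1) (\<lambda>(r, s).
     if r = 0 \<and> s = 0 then 0
     else if r = 0 then - mps_const (1 / sqrt 2) * schur_q x s
     else if s = 0 then mps_const (1 / sqrt 2) * schur_q x r
     else mps_const (1 / 2) * two_row_Q x r s)"

text \<open>The two disjoint sequences of indeterminates.\<close>

abbreviation x_vars :: "nat \<Rightarrow> nat + nat" where "x_vars \<equiv> Inl"
abbreviation y_vars :: "nat \<Rightarrow> nat + nat" where "y_vars \<equiv> Inr"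

end

theory Submission
  imports Defs
begin

text \<open>
  Both sides of the identity come from one Pfaffian. Take two copies \<open>\<eta>\<^sub>i\<close> and \<open>\<xi>\<^sub>i\<close> of the indices
  \<open>0, \<dots>, h\<close> and the antisymmetric matrix that is \<open>K\<^sub>h(x)\<close> on the \<open>\<eta>\<^sub>i\<close>, the transpose of \<open>K\<^sub>h(y)\<close> on the
  \<open>\<xi>\<^sub>i\<close>, and pairs \<open>\<eta>\<^sub>i\<close> with \<open>\<xi>\<^sub>i\<close> to 1. In the expansion of its Pfaffian each \<open>\<eta>\<^sub>i\<close> is either matched with
  its partner \<open>\<xi>\<^sub>i\<close> through the coupling or left over. The indices left over form a set \<open>S\<close>, which
  contributes \<open>Pf K\<^sub>h(x)\<^sub>S Pf K\<^sub>h(y)\<^sub>S\<close> (\<open>pf_coupled_form\<close>). On the other hand the square of a Pfaffian is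
  the determinant (\<open>pf_square\<close>), which block operations turn into that of \<open>1 - K\<^sub>h(x) K\<^sub>h(y)\<close>
  (\<open>gram_det_coupled_form\<close>). Only the sets \<open>S\<close> of even size contribute. They are the
  strict partitions with largest part at most \<open>h\<close>, completed by a part 0 if the length is odd, and
  the scaling of \<open>K\<^sub>h\<close> makes the contribution equal to \<open>Q\<^sub>\<lambda>(x) P\<^sub>\<lambda>(y)\<close>, given that \<open>Q\<^sub>\<lambda>\<close> is
  the Pfaffian of the functions \<open>Q\<^sub>(\<^sub>r\<^sub>,\<^sub>s\<^sub>)\<close> with \<open>r, s\<close> among the parts of \<open>\<lambda>\<close>.

  The square of the Pfaffian is needed only for a matrix of power series whose constant term is the
  standard symplectic matrix. All pivots are then units, and symplectic Gaussian elimination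
  (\<open>pf_eliminate\<close>, \<open>gram_det_eliminate\<close>) proves it directly over the ring of power series.

  The Pfaffian formula for \<open>Q\<^sub>\<lambda>\<close> (\<open>schur_Q_eq_pf\<close>) is derived from tableaux by adding one letter at a
  time. The boxes with the largest letter form a vertical strip if the letter is marked and a
  horizontal strip if it is not (\<open>tableau_sum_Suc\<close>). Removing a vertical strip replaces every part \<open>a\<close>
  by \<open>a\<close> or \<open>a - 1\<close> independently, an operation that passes through the Pfaffian by
  linearity in every index. Removing a horizontal strip with weight \<open>x\<close> is the inverse of removing a
  vertical strip with weight \<open>- x\<close> (\<open>multisum_interlacing_step_down\<close>). It remains to compare the
  two-row functions before and after the addition of a variable \<open>x\<close>: taking away vertical strips
  with weight \<open>x\<close> from the former and with weight \<open>- x\<close> from the latter gives the same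
  (\<open>two_row_strip\<close>), because the generating series of the \<open>q\<^sub>k\<close> gets multiplied by
  \<open>(1 + x t) / (1 - x t)\<close>. Infinitely many variables are no
  problem, since each coefficient involves only finitely many.
\<close>

section \<open>Lists with one entry removed\<close>

definition drop_nth :: "nat \<Rightarrow> 'i list \<Rightarrow> 'i list" where
  "drop_nth j xs = take j xs @ drop (Suc j) xs"

lemma length_drop_nth: "j < length xs \<Longrightarrow> length (drop_nth j xs) = length xs - 1"
  by (simp add: drop_nth_def)

lemma set_drop_nth: "set (drop_nth j xs) \<subseteq> set xs"
  unfolding drop_nth_def by (auto dest: in_set_takeD in_set_dropD)

lemma drop_nth_append:
  "drop_nth j (xs @ ys) = (if j < length xs then drop_nth j xs @ ys
     else xs @ drop_nth (j - length xs) ys)"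
proof (cases "j < length xs")
  case False
  then obtain k where "j = length xs + k" by (metis le_add_diff_inverse not_less)
  then show ?thesis by (simp add: drop_nth_def)
qed (simp add: drop_nth_def)

lemma drop_nth_0 [simp]: "drop_nth 0 (x # xs) = xs"
  by (simp add: drop_nth_def)

lemma drop_nth_Suc [simp]: "drop_nth (Suc j) (x # xs) = x # drop_nth j xs"
  by (simp add: drop_nth_def)

lemma map_drop_nth: "map f (drop_nth j xs) = drop_nth j (map f xs)"
  by (simp add: drop_nth_def take_map drop_map)

lemma nth_drop_nth:
  "j < length xs \<Longrightarrow> k < length xs - 1 \<Longrightarrow> drop_nth j xs ! k = (if k < j then xs ! k else xs ! Suc k)"
  by (auto simp: drop_nth_def nth_append)

lemma drop_nth_drop_nth:
  "j \<le> k \<Longrightarrow> Suc k < length xs \<Longrightarrow> drop_nth k (drop_nth j xs) = drop_nth j (drop_nth (Suc k) xs)"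
proof (induction xs arbitrary: j k)
  case (Cons x xs)
  show ?case
    using Cons.prems Cons.IH[of "j - 1" "k - 1"] by (cases j; cases k) simp_all
qed simp

lemma sorted_wrt_drop_nth:
  assumes "sorted_wrt P xs"
  shows "sorted_wrt P (drop_nth j xs)"
proof -
  have "sorted_wrt P (take j xs @ drop j xs)" using assms by simp
  then have "\<forall>x\<in>set (take j xs). \<forall>y\<in>set (drop j xs). P x y"
    unfolding sorted_wrt_append by blast
  moreover have "set (drop (Suc j) xs) \<subseteq> set (drop j xs)"
    by (rule set_drop_subset_set_drop) simp
  ultimately show ?thesis
    using assms unfolding drop_nth_def sorted_wrt_append
    by (auto intro: sorted_wrt_take sorted_wrt_drop)
qed

section \<open>Pfaffians\<close>

text \<open>
  The Pfaffian of the matrix with rows and columns indexed by a list, expanded along the first index.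
  Only the entries \<open>M a b\<close> with \<open>a\<close> before \<open>b\<close> in the list are read, and \<open>M\<close> need not be
  antisymmetric. This freedom is used for the two-row functions of a strict partition: there the pair
  \<open>(0, 0)\<close> gets the value 1, and appending two zeros to a list of indices changes nothing.
\<close>

function pf :: "('i \<Rightarrow> 'i \<Rightarrow> 'a :: comm_ring_1) \<Rightarrow> 'i list \<Rightarrow> 'a" where
  "pf M [] = 1"
| "pf M (a # xs) = (\<Sum>j<length xs. (- 1) ^ j * M a (xs ! j) * pf M (drop_nth j xs))"
  by pat_completeness auto
termination
  by (relation "Wellfounded.measure (\<lambda>(M, xs). length xs)") (auto simp: drop_nth_def)

declare pf.simps(2) [simp del]
lemmas pf_Cons = pf.simps(2)

lemma pf_singleton [simp]: "pf M [a] = 0"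
  by (simp add: pf_Cons)

lemma sum_lessThan_add:
  "(\<Sum>j<m + n. f j) = (\<Sum>j<m. f j) + (\<Sum>j<n. f (m + j :: nat) :: 'a :: comm_monoid_add)"
  by (induction n) (auto simp: add.assoc)

text \<open>
  The expansion of a Pfaffian is an alternating sum over the ways of deleting one index. This
  lemma and the next split such a sum when the list of indices is cut.
\<close>

lemma alternating_sum_append:
  fixes m :: "'i \<Rightarrow> 'a :: comm_ring_1"
  shows "(\<Sum>j<length (xs @ ys). (- 1) ^ j * m ((xs @ ys) ! j) * g (drop_nth j (xs @ ys)))
    = (\<Sum>j<length xs. (- 1) ^ j * m (xs ! j) * g (drop_nth j xs @ ys))
      + (- 1) ^ length xs * (\<Sum>j<length ys. (- 1) ^ j * m (ys ! j) * g (xs @ drop_nth j ys))"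
  unfolding length_append sum_lessThan_add sum_distrib_left
  by (intro arg_cong2[of _ _ _ _ "(+)"] sum.cong refl)
     (auto simp: drop_nth_append nth_append power_add mult.assoc)

lemma alternating_sum_Cons:
  fixes m :: "'i \<Rightarrow> 'a :: comm_ring_1"
  shows "(\<Sum>j<length (c # ys). (- 1) ^ j * m ((c # ys) ! j) * g (drop_nth j (c # ys)))
    = m c * g ys - (\<Sum>j<length ys. (- 1) ^ j * m (ys ! j) * g (c # drop_nth j ys))"
  by (simp add: sum.lessThan_Suc_shift sum_negf del: sum.lessThan_Suc)

lemma pf_Cons_append:
  "pf M (a # xs @ ys) = (\<Sum>j<length xs. (- 1) ^ j * M a (xs ! j) * pf M (drop_nth j xs @ ys))
     + (- 1) ^ length xs * (\<Sum>j<length ys. (- 1) ^ j * M a (ys ! j) * pf M (xs @ drop_nth j ys))"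
  unfolding pf_Cons by (rule alternating_sum_append)

lemma pf_Cons_append_Cons:
  "pf M (a # xs @ c # ys) = (\<Sum>j<length xs. (- 1) ^ j * M a (xs ! j) * pf M (drop_nth j xs @ c # ys))
     + (- 1) ^ length xs * (M a c * pf M (xs @ ys)
         - (\<Sum>j<length ys. (- 1) ^ j * M a (ys ! j) * pf M (xs @ c # drop_nth j ys)))"
  unfolding pf_Cons_append alternating_sum_Cons[of "M a" c ys "\<lambda>zs. pf M (xs @ zs)"] ..

lemma pf_Cons_append_Cons2:
  "pf M (a # xs @ b # c # ys)
     = (\<Sum>j<length xs. (- 1) ^ j * M a (xs ! j) * pf M (drop_nth j xs @ b # c # ys))
     + (- 1) ^ length xs * (M a b * pf M (xs @ c # ys) - M a c * pf M (xs @ b # ys)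
         + (\<Sum>j<length ys. (- 1) ^ j * M a (ys ! j) * pf M (xs @ b # c # drop_nth j ys)))"
  unfolding pf_Cons_append_Cons
  by (simp add: sum.lessThan_Suc_shift sum_negf diff_diff_eq2 diff_add_eq del: sum.lessThan_Suc)

lemma pf_map: "pf M (map f xs) = pf (\<lambda>a b. M (f a) (f b)) xs"
proof (induction "length xs" arbitrary: xs rule: less_induct)
  case less
  then show ?case
    by (cases xs) (auto simp: pf_Cons map_drop_nth[symmetric] length_drop_nth intro!: sum.cong)
qed

lemma pf_cong:
  assumes "sorted_wrt (\<lambda>a b. M a b = M' a b) xs"
  shows "pf M xs = pf M' xs"
  using assms
proof (induction "length xs" arbitrary: xs rule: less_induct)
  case less
  show ?case
  proof (cases xs)
    case (Cons a ys)
    have *: "sorted_wrt (\<lambda>a b. M a b = M' a b) ys" using less.prems Cons by simp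
    then have "sorted_wrt (\<lambda>a b. M a b = M' a b) (drop_nth j ys)" for j
      by (rule sorted_wrt_drop_nth)
    then show ?thesis
      using less.prems less.hyps Cons by (auto simp: pf_Cons length_drop_nth intro!: sum.cong)
  qed simp
qed

lemma pf_odd: "odd (length xs) \<Longrightarrow> pf M xs = 0"
proof (induction "length xs" arbitrary: xs rule: less_induct)
  case less
  then obtain a ys where xs: "xs = a # ys" by (cases xs) auto
  have "pf M (drop_nth j ys) = 0" if "j < length ys" for j
    using less that xs by (intro less.hyps) (auto simp: length_drop_nth)
  then show ?case by (simp add: pf_Cons xs)
qed

lemma pf_scale:
  "pf (\<lambda>a b. c a * c b * M a b) xs = prod_list (map c xs) * pf M xs"
proof (induction "length xs" arbitrary: xs rule: less_induct)
  case less
  show ?case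
  proof (cases xs)
    case (Cons a ys)
    have "prod_list (map c ys) = c (ys ! j) * prod_list (map c (drop_nth j ys))" if "j < length ys" for j
      using that by (subst id_take_nth_drop[OF that]) (simp add: drop_nth_def ac_simps)
    then show ?thesis
      using less.hyps Cons
      by (auto simp: pf_Cons length_drop_nth sum_distrib_left ac_simps intro!: sum.cong)
  qed simp
qed

text \<open>
  An index stands for a vector, and the Pfaffian is linear in each of them: if \<open>c\<close> pairs with all other
  indices like the combination of the \<open>f t\<close> with weights \<open>w t\<close>, then \<open>c\<close> may be replaced by that
  combination. In this form linearity serves both row operations and the substitution of
  indices by sums of indices.
\<close>

lemma pf_linear:
  assumes "\<And>z. z \<in> set as \<union> set bs \<Longrightarrow> M c z = (\<Sum>t\<in>S. w t * M (f t) z)"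
    and "\<And>z. z \<in> set as \<union> set bs \<Longrightarrow> M z c = (\<Sum>t\<in>S. w t * M z (f t))"
  shows "pf M (as @ c # bs) = (\<Sum>t\<in>S. w t * pf M (as @ f t # bs))"
  using assms
proof (induction "length as + length bs" arbitrary: as bs rule: less_induct)
  case less
  show ?case
  proof (cases as)
    case Nil
    have "pf M (c # bs) = (\<Sum>j<length bs. \<Sum>t\<in>S. w t * ((- 1) ^ j * M (f t) (bs ! j) * pf M (drop_nth j bs)))"
      using less.prems(1) by (simp add: pf_Cons sum_distrib_left sum_distrib_right ac_simps)
    also have "\<dots> = (\<Sum>t\<in>S. w t * pf M (f t # bs))"
      by (subst sum.swap) (simp add: pf_Cons sum_distrib_left)
    finally show ?thesis by (simp add: Nil)
  next
    case (Cons a xs)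
    have IH1: "pf M (drop_nth j xs @ c # bs) = (\<Sum>t\<in>S. w t * pf M (drop_nth j xs @ f t # bs))"
      if "j < length xs" for j
      using less.prems that Cons set_drop_nth[of j xs]
      by (intro less.hyps) (auto simp: length_drop_nth)
    have IH2: "pf M (xs @ c # drop_nth j bs) = (\<Sum>t\<in>S. w t * pf M (xs @ f t # drop_nth j bs))"
      if "j < length bs" for j
      using less.prems that Cons set_drop_nth[of j bs]
      by (intro less.hyps) (auto simp: length_drop_nth)
    have A: "(\<Sum>j<length xs. (- 1) ^ j * M a (xs ! j) * pf M (drop_nth j xs @ c # bs))
      = (\<Sum>t\<in>S. w t * (\<Sum>j<length xs. (- 1) ^ j * M a (xs ! j) * pf M (drop_nth j xs @ f t # bs)))"
      by (simp add: IH1 sum_distrib_left, subst sum.swap) (simp add: ac_simps)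
    have B: "(\<Sum>j<length bs. (- 1) ^ j * M a (bs ! j) * pf M (xs @ c # drop_nth j bs))
      = (\<Sum>t\<in>S. w t * (\<Sum>j<length bs. (- 1) ^ j * M a (bs ! j) * pf M (xs @ f t # drop_nth j bs)))"
      by (simp add: IH2 sum_distrib_left, subst sum.swap) (simp add: ac_simps)
    have C: "M a c * pf M (xs @ bs) = (\<Sum>t\<in>S. w t * (M a (f t) * pf M (xs @ bs)))"
      using less.prems(2)[of a] Cons by (simp add: sum_distrib_right mult.assoc)
    show ?thesis
      unfolding Cons append_Cons pf_Cons_append_Cons A B C
      by (simp add: distrib_left right_diff_distrib sum.distrib sum_subtractf sum_distrib_left ac_simps)
  qed
qed

text \<open>
  Expanding along the first two indices deletes two further ones, \<open>i < j\<close>, in either order; the two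
  orders have opposite signs and combine to a two-by-two minor of the first two rows.
\<close>

lemma pf_Cons_Cons:
  "pf M (b # c # xs) = M b c * pf M xs
     + (\<Sum>(i, j) | i < j \<and> j < length xs. (- 1) ^ (i + j)
         * (M b (xs ! i) * M c (xs ! j) - M b (xs ! j) * M c (xs ! i)) * pf M (drop_nth i (drop_nth j xs)))"
proof -
  let ?n = "length xs"
  let ?P = "{(i, j). i < j \<and> j < ?n}"
  let ?t = "\<lambda>j k. (- 1) ^ (j + k) * M b (xs ! j) * M c (drop_nth j xs ! k) * pf M (drop_nth k (drop_nth j xs))"
  have fin: "finite ?P" by (rule finite_subset[of _ "{..<?n} \<times> {..<?n}"]) auto
  have "(\<Sum>j<?n. (- 1) ^ j * M b (xs ! j) * pf M (c # drop_nth j xs))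
      = (\<Sum>j<?n. \<Sum>k<?n - 1. ?t j k)"
    by (auto simp: pf_Cons length_drop_nth sum_distrib_left power_add ac_simps intro!: sum.cong)
  also have "\<dots> = (\<Sum>(j, k)\<in>{..<?n} \<times> {..<?n - 1}. ?t j k)"
    by (simp add: sum.cartesian_product)
  also have "\<dots> = (\<Sum>(j, k) | k < j \<and> j < ?n. ?t j k) + (\<Sum>(j, k) | j \<le> k \<and> Suc k < ?n. ?t j k)"
  proof (subst sum.union_disjoint[symmetric])
    show "finite {(j, k). k < j \<and> j < ?n}" "finite {(j, k). j \<le> k \<and> Suc k < ?n}"
      by (rule finite_subset[of _ "{..<?n} \<times> {..<?n}"]; auto)+
  qed (auto intro!: sum.cong)
  also have "(\<Sum>(j, k) | k < j \<and> j < ?n. ?t j k)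
      = (\<Sum>(i, j)\<in>?P. (- 1) ^ (i + j) * (M b (xs ! j) * M c (xs ! i)) * pf M (drop_nth i (drop_nth j xs)))"
    by (rule sum.reindex_bij_witness[of _ prod.swap prod.swap]) (auto simp: nth_drop_nth ac_simps)
  also have "(\<Sum>(j, k) | j \<le> k \<and> Suc k < ?n. ?t j k)
      = (\<Sum>(i, j)\<in>?P. - ((- 1) ^ (i + j) * (M b (xs ! i) * M c (xs ! j)) * pf M (drop_nth i (drop_nth j xs))))"
    by (rule sum.reindex_bij_witness[of _ "\<lambda>(i, j). (i, j - 1)" "\<lambda>(j, k). (j, Suc k)"])
       (auto simp: nth_drop_nth drop_nth_drop_nth ac_simps)
  finally have *: "(\<Sum>j<?n. (- 1) ^ j * M b (xs ! j) * pf M (c # drop_nth j xs)) = 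
      (\<Sum>(i, j)\<in>?P. (- 1) ^ (i + j) * (M b (xs ! j) * M c (xs ! i)) * pf M (drop_nth i (drop_nth j xs)))
      + (\<Sum>(i, j)\<in>?P. - ((- 1) ^ (i + j) * (M b (xs ! i) * M c (xs ! j)) * pf M (drop_nth i (drop_nth j xs))))" .
  have "(\<Sum>(i, j)\<in>?P. (- 1) ^ (i + j) * (M b (xs ! i) * M c (xs ! j) - M b (xs ! j) * M c (xs ! i))
        * pf M (drop_nth i (drop_nth j xs)))
    = - (\<Sum>j<?n. (- 1) ^ j * M b (xs ! j) * pf M (c # drop_nth j xs))"
    unfolding * sum.distrib[symmetric] sum_negf[symmetric]
    by (intro sum.cong) (auto simp: algebra_simps)
  then show ?thesis
    using pf_Cons_append_Cons[of M b "[]" c xs] by simp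
qed

text \<open>
  The Clifford relation: Pfaffians of lists behave like vacuum expectations of products of
  generators \<open>b\<close>, \<open>c\<close> with the anticommutator \<open>M b c + M c b\<close>.
\<close>

lemma pf_swap:
  "pf M (as @ b # c # bs) + pf M (as @ c # b # bs) = (M b c + M c b) * pf M (as @ bs)"
proof (induction "length as + length bs" arbitrary: as bs rule: less_induct)
  case less
  show ?case
  proof (cases as)
    case Nil
    show ?thesis
      by (simp add: Nil pf_Cons_Cons algebra_simps flip: sum.distrib) (simp add: case_prod_unfold algebra_simps)
  next
    case (Cons a xs)
    have IH1: "pf M (drop_nth j xs @ b # c # bs)
      = (M b c + M c b) * pf M (drop_nth j xs @ bs) - pf M (drop_nth j xs @ c # b # bs)"
      if "j < length xs" for j
      using less(1)[of "drop_nth j xs" bs] that Cons by (simp add: length_drop_nth algebra_simps)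
    have IH2: "pf M (xs @ b # c # drop_nth j bs)
      = (M b c + M c b) * pf M (xs @ drop_nth j bs) - pf M (xs @ c # b # drop_nth j bs)"
      if "j < length bs" for j
      using less(1)[of xs "drop_nth j bs"] that Cons by (simp add: length_drop_nth algebra_simps)
    show ?thesis
      unfolding Cons append_Cons pf_Cons_append_Cons2 pf_Cons_append[of M a xs bs]
      by (simp add: IH1 IH2 algebra_simps sum_distrib_left sum_subtractf sum.distrib)
  qed
qed

lemma pf_adjacent_equal:
  "pf M (as @ r # r # bs) = M r r * pf M (as @ bs)"
proof (induction "length as + length bs" arbitrary: as bs rule: less_induct)
  case less
  show ?case
  proof (cases as)
    case Nil
    show ?thesis
      by (simp add: Nil pf_Cons_Cons case_prod_unfold algebra_simps)
  next
    case (Cons a xs)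
    have IH1: "pf M (drop_nth j xs @ r # r # bs) = M r r * pf M (drop_nth j xs @ bs)"
      if "j < length xs" for j
      using less(1)[of "drop_nth j xs" bs] that Cons by (simp add: length_drop_nth)
    have IH2: "pf M (xs @ r # r # drop_nth j bs) = M r r * pf M (xs @ drop_nth j bs)"
      if "j < length bs" for j
      using less(1)[of xs "drop_nth j bs"] that Cons by (simp add: length_drop_nth)
    show ?thesis
      unfolding Cons append_Cons pf_Cons_append_Cons2 pf_Cons_append[of M a xs bs]
      by (simp add: IH1 IH2 algebra_simps sum_distrib_left)
  qed
qed

lemma pf_zero_vector:
  assumes "\<And>z. z \<in> set as \<union> set bs \<Longrightarrow> M u z = 0 \<and> M z u = 0"
  shows "pf M (as @ u # bs) = 0"
  using pf_linear[where as = as and bs = bs and M = M and c = u and S = "{} :: nat set"] assms by simp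

text \<open>
  If \<open>u\<close> pairs with nothing but \<open>v\<close>, every perfect matching that contributes contains the
  edge from \<open>u\<close> to \<open>v\<close>; the sign counts the indices between them.
\<close>

lemma pf_isolated:
  assumes "\<And>z. z \<in> set as \<union> set cs \<union> set bs \<Longrightarrow> M u z = 0 \<and> M z u = 0"
  shows "pf M (as @ u # cs @ v # bs) = (- 1) ^ length cs * M u v * pf M (as @ cs @ bs)"
  using assms
proof (induction "length as + length cs + length bs" arbitrary: as cs bs rule: less_induct)
  case less
  show ?case
  proof (cases as)
    case Nil
    then show ?thesis using less.prems by (simp add: pf_Cons_append_Cons)
  next
    case (Cons a xs)
    let ?c = "(- 1) ^ length cs * M u v"
    have IH1: "pf M (drop_nth j xs @ u # cs @ v # bs) = ?c * pf M (drop_nth j xs @ cs @ bs)"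
      if "j < length xs" for j
      using less.prems set_drop_nth[of j xs] that Cons by (intro less.hyps) (auto simp: length_drop_nth)
    have IH2: "pf M (xs @ u # drop_nth j cs @ v # bs) = - (?c * pf M (xs @ drop_nth j cs @ bs))"
      if j: "j < length cs" for j
    proof -
      obtain k where k: "length cs = Suc k" using j by (cases "length cs") auto
      have "pf M (xs @ u # drop_nth j cs @ v # bs)
          = (- 1) ^ length (drop_nth j cs) * M u v * pf M (xs @ drop_nth j cs @ bs)"
        using less.prems set_drop_nth[of j cs] j Cons
        by (intro less.hyps) (auto simp: length_drop_nth)
      then show ?thesis using j k by (simp add: length_drop_nth)
    qed
    have IH3: "pf M (xs @ u # cs @ v # drop_nth j bs) = ?c * pf M (xs @ cs @ drop_nth j bs)"
      if "j < length bs" for j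
      using less.prems set_drop_nth[of j bs] that Cons by (intro less.hyps) (auto simp: length_drop_nth)
    have zero: "pf M (xs @ u # cs @ bs) = 0"
      using less.prems Cons by (intro pf_zero_vector) auto
    have au: "M a u = 0" using less.prems Cons by auto
    have L: "pf M (a # xs @ u # cs @ v # bs) = 
        (\<Sum>j<length xs. (- 1) ^ j * M a (xs ! j) * pf M (drop_nth j xs @ u # cs @ v # bs))
      - (- 1) ^ length xs * (\<Sum>j<length cs. (- 1) ^ j * M a (cs ! j) * pf M (xs @ u # drop_nth j cs @ v # bs))
      + (- 1) ^ length xs * (- 1) ^ length cs *
        (\<Sum>j<length bs. (- 1) ^ j * M a (bs ! j) * pf M (xs @ u # cs @ v # drop_nth j bs))"
      unfolding pf_Cons_append_Cons
        alternating_sum_append[of "M a" cs "v # bs" "\<lambda>zs. pf M (xs @ u # zs)"]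
        alternating_sum_Cons[of "M a" v bs "\<lambda>zs. pf M (xs @ u # cs @ zs)"]
      by (simp add: au zero algebra_simps)
    have R: "pf M (a # xs @ cs @ bs) = 
        (\<Sum>j<length xs. (- 1) ^ j * M a (xs ! j) * pf M (drop_nth j xs @ cs @ bs))
      + (- 1) ^ length xs * (\<Sum>j<length cs. (- 1) ^ j * M a (cs ! j) * pf M (xs @ drop_nth j cs @ bs))
      + (- 1) ^ length xs * (- 1) ^ length cs *
        (\<Sum>j<length bs. (- 1) ^ j * M a (bs ! j) * pf M (xs @ cs @ drop_nth j bs))"
      unfolding pf_Cons_append alternating_sum_append[of "M a" cs bs "\<lambda>zs. pf M (xs @ zs)"]
      by (simp add: algebra_simps)
    show ?thesis
      unfolding Cons append_Cons L R
      by (simp add: IH1 IH2 IH3 sum_negf sum_distrib_left algebra_simps)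
  qed
qed

text \<open>
  Matchings between two orthogonal blocks do not contribute. If both blocks have odd length, both
  sides vanish.
\<close>

lemma pf_append_orthogonal:
  assumes "\<And>a b. a \<in> set as \<Longrightarrow> b \<in> set bs \<Longrightarrow> M a b = 0"
  shows "pf M (as @ bs) = pf M as * pf M bs"
  using assms
proof (induction "length as" arbitrary: as rule: less_induct)
  case less
  show ?case
  proof (cases as)
    case (Cons a xs)
    have "pf M (drop_nth j xs @ bs) = pf M (drop_nth j xs) * pf M bs" if "j < length xs" for j
      using less.prems set_drop_nth[of j xs] that Cons by (intro less.hyps) (auto simp: length_drop_nth)
    then show ?thesis
      unfolding Cons append_Cons pf_Cons_append pf_Cons[of M a xs]
      using less.prems Cons by (simp add: sum_distrib_right mult.assoc)
  qed simp
qed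

lemma pf_uminus: "pf (\<lambda>a b. - M a b) xs = (- 1) ^ (length xs div 2) * pf M xs"
proof (induction "length xs" arbitrary: xs rule: less_induct)
  case less
  show ?case
  proof (cases xs)
    case (Cons a ys)
    let ?s = "(- 1) ^ ((length ys - 1) div 2)"
    have IH: "pf (\<lambda>a b. - M a b) (drop_nth j ys) = ?s * pf M (drop_nth j ys)" if "j < length ys" for j
      using less.hyps[of "drop_nth j ys"] that Cons by (simp add: length_drop_nth)
    have "pf (\<lambda>a b. - M a b) (a # ys) = - ?s * pf M (a # ys)"
      by (simp add: pf_Cons IH sum_distrib_left sum_negf ac_simps)
    also have "- ?s * pf M (a # ys) = (- 1) ^ (length (a # ys) div 2) * pf M (a # ys)"
      by (cases ys) auto
    finally show ?thesis by (simp only: Cons)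
  qed simp
qed

section \<open>Alternating forms and symplectic elimination\<close>

locale alternating_form =
  fixes M :: "'i \<Rightarrow> 'i \<Rightarrow> 'a :: comm_ring_1"
  assumes skew: "M a b = - M b a" and diag [simp]: "M a a = 0"
begin

lemma pf_move: "pf M (as @ c # cs @ bs) = (- 1) ^ length cs * pf M (as @ cs @ c # bs)"
proof (induction cs arbitrary: as)
  case (Cons d cs)
  have "pf M (as @ c # d # cs @ bs) + pf M (as @ d # c # cs @ bs) = 0"
    unfolding pf_swap by (simp add: skew[of c d])
  then have "pf M (as @ c # d # cs @ bs) = - pf M ((as @ [d]) @ c # cs @ bs)"
    by (simp add: eq_neg_iff_add_eq_0)
  also have "\<dots> = - ((- 1) ^ length cs * pf M ((as @ [d]) @ cs @ c # bs))"
    by (simp only: Cons.IH)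
  finally show ?case by simp
qed simp

lemma pf_repeated: "pf M (as @ c # cs @ c # bs) = 0"
  using pf_move[of as c cs "c # bs"] pf_adjacent_equal[of M "as @ cs" c bs] by simp

lemma pf_append_rev: "pf M (as @ rev xs) = (- 1) ^ (length xs choose 2) * pf M (as @ xs)"
proof (induction xs arbitrary: as)
  case (Cons x xs)
  have "pf M (as @ rev xs @ [x]) = (- 1) ^ length xs * pf M (as @ x # rev xs)"
    using pf_move[of as x "rev xs" "[]"] by (simp flip: mult.assoc power_add)
  also have "pf M (as @ x # rev xs) = (- 1) ^ (length xs choose 2) * pf M (as @ x # xs)"
    using Cons.IH[of "as @ [x]"] by simp
  finally show ?case by (simp add: numeral_2_eq_2 power_add)
qed (simp add: numeral_2_eq_2)

text \<open>
  Transposition contributes one sign for each pair of indices that is matched, reversal one sign for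
  each pair of positions, and for lists of even length these signs cancel.
\<close>

lemma pf_transpose_rev: "pf (\<lambda>a b. M b a) (rev xs) = pf M xs"
proof (cases "even (length xs)")
  case True
  then obtain k where k: "length xs = 2 * k" by blast
  have "(\<lambda>a b. M b a) = (\<lambda>a b. - M a b)" using skew by blast
  then have "pf (\<lambda>a b. M b a) (rev xs) = (- 1) ^ (k + (2 * k choose 2)) * pf M xs"
    using pf_append_rev[of "[]" xs] by (simp add: pf_uminus k power_add mult.assoc)
  also have "k + (2 * k choose 2) = 2 * (k * k)"
    by (cases k) (auto simp: choose_two algebra_simps)
  finally show ?thesis by (simp add: power_mult)
qed (simp add: pf_odd)

text \<open>
  With \<open>q\<close> the inverse of \<open>M u v\<close>, this is the form \<open>M\<close> after projecting every vector to the
  orthogonal complement of \<open>u\<close> and \<open>v\<close>: the Schur complement of the block of \<open>u\<close> and \<open>v\<close>.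
\<close>

definition eliminate :: "'i \<Rightarrow> 'i \<Rightarrow> 'a \<Rightarrow> 'i \<Rightarrow> 'i \<Rightarrow> 'a" where
  "eliminate u v q a b = M a b + q * (M a u * M v b - M a v * M u b)"

lemma alternating_eliminate: "alternating_form (eliminate u v q)"
proof
  show "eliminate u v q a a = 0" for a
    by (simp add: eliminate_def skew[of v a] skew[of u a])
  show "eliminate u v q a b = - eliminate u v q b a" for a b
    by (simp add: eliminate_def skew[of v] skew[of u] skew[of a b] algebra_simps)
qed

text \<open>
  One step of symplectic Gaussian elimination. Adding multiples of \<open>u\<close> and \<open>v\<close> to the other vectors
  does not change the Pfaffian, since a Pfaffian with a repeated index vanishes. Once the other
  vectors are orthogonal to \<open>u\<close> and \<open>v\<close>, these two can only be matched with each other.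
\<close>

lemma pf_eliminate:
  assumes q: "M u v * q = 1" and even: "even (length xs)"
  shows "pf M (u # xs @ [v]) = M u v * pf (eliminate u v q) xs"
proof -
  \<comment> \<open>On the indices of the form N, Inl z is the vector z itself and Inr z is its projection.
      A projection pairs with a vector as with the projection of that vector.\<close>
  define P where "P = eliminate u v q"
  define N :: "'i + 'i \<Rightarrow> 'i + 'i \<Rightarrow> 'a" where
    "N = (\<lambda>s t. case (s, t) of (Inl a, Inl b) \<Rightarrow> M a b | (Inl a, Inr b) \<Rightarrow> P a b
       | (Inr a, Inl b) \<Rightarrow> P a b | (Inr a, Inr b) \<Rightarrow> P a b)"
  have N [simp]: "N (Inl a) (Inl b) = M a b" "N (Inl a) (Inr b) = P a b"
    "N (Inr a) (Inl b) = P a b" "N (Inr a) (Inr b) = P a b" for a b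
    by (simp_all add: N_def)
  interpret P: alternating_form P unfolding P_def by (rule alternating_eliminate)
  interpret N: alternating_form N
  proof
    show "N a b = - N b a" for a b
      by (cases a; cases b) (simp_all add: skew[symmetric] P.skew[symmetric])
    show "N a a = 0" for a by (cases a) simp_all
  qed
  have Pu: "P u b = 0" for b
  proof -
    have "P u b = M u b - (M u v * q) * M u b" by (simp add: P_def eliminate_def ac_simps)
    then show ?thesis by (simp add: q)
  qed
  have Pv: "P v b = 0" for b
  proof -
    have "P v b = M v b - (M u v * q) * M v b"
      by (simp add: P_def eliminate_def skew[of v u] ac_simps)
    then show ?thesis by (simp add: q)
  qed
  have Pu': "P b u = 0" for b using P.skew[of b u] Pu by simp
  have Pv': "P b v = 0" for b using P.skew[of b v] Pv by simp
  have project: "pf N (Inl u # map Inr as @ map Inl bs @ [Inl v]) = pf N (map Inl (u # as @ bs @ [v]))"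
    for as bs
  proof (induction as arbitrary: bs rule: rev_induct)
    case (snoc a as)
    let ?as = "Inl u # map Inr as" and ?bs = "map Inl bs @ [Inl v]"
    \<comment> \<open>The projection of a is a - q * M a v * u + q * M a u * v.\<close>
    let ?w = "\<lambda>t::nat. if t = 0 then 1 else if t = 1 then - q * M a v else q * M a u"
    let ?f = "\<lambda>t::nat. if t = 0 then Inl a else if t = 1 then Inl u else Inl v"
    have "pf N (?as @ Inr a # ?bs) = (\<Sum>t<3. ?w t * pf N (?as @ ?f t # ?bs))"
    proof (rule pf_linear)
      show left: "N (Inr a) z = (\<Sum>t<3. ?w t * N (?f t) z)" for z
        by (cases z) (simp_all add: numeral_3_eq_3 Pu Pv, simp add: P_def eliminate_def algebra_simps)
      show "N z (Inr a) = (\<Sum>t<3. ?w t * N z (?f t))" for z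
        unfolding N.skew[of z "Inr a"] left sum_negf[symmetric] mult_minus_right[symmetric]
          N.skew[of z, symmetric] ..
    qed
    also have "\<dots> = pf N (?as @ Inl a # ?bs)"
      using N.pf_repeated[of "[]" "Inl u" "map Inr as" ?bs]
        N.pf_repeated[of ?as "Inl v" "map Inl bs" "[]"]
      by (simp add: numeral_3_eq_3)
    also have "\<dots> = pf N (map Inl (u # as @ (a # bs) @ [v]))"
      using snoc.IH[of "a # bs"] by simp
    finally show ?case by simp
  qed simp
  have orth: "N (Inl u) z = 0 \<and> N z (Inl u) = 0"
    if "z \<in> set [] \<union> set (map Inr xs) \<union> set []" for z
    using that by (auto simp: Pu Pu')
  have "pf M (u # xs @ [v]) = pf N (map Inl (u # xs @ [v]))"
    by (simp add: pf_map del: map_append list.map)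
  also have "\<dots> = pf N ([] @ Inl u # map Inr xs @ Inl v # [])"
    using project[of xs "[]"] by simp
  also have "\<dots> = (- 1) ^ length xs * N (Inl u) (Inl v) * pf N ([] @ map Inr xs @ [])"
    using pf_isolated[of "[]" "map Inr xs" "[]" N, OF orth] by simp
  also have "\<dots> = M u v * pf P xs"
    using even by (simp add: pf_map)
  finally show ?thesis by (simp add: P_def)
qed

end

section \<open>Substitution of indices in a Pfaffian\<close>

text \<open>
  Independent choices: every entry \<open>j\<close> of a list is replaced by some \<open>k\<close> in \<open>S j\<close>, with weight \<open>w j k\<close>.
  The recursive form, rather than a sum over lists, makes the operators of this kind easy to compose.
\<close>

fun multisum :: "('j \<Rightarrow> 'k set) \<Rightarrow> ('j \<Rightarrow> 'k \<Rightarrow> 'a) \<Rightarrow> ('k list \<Rightarrow> 'a) \<Rightarrow> 'j list \<Rightarrow> 'a :: comm_ring_1" where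
  "multisum S w F [] = F []"
| "multisum S w F (j # js) = (\<Sum>k\<in>S j. w j k * multisum S w (\<lambda>ks. F (k # ks)) js)"

lemma multisum_cong:
  "(\<And>ks. list_all2 (\<lambda>j k. k \<in> S j) js ks \<Longrightarrow> F ks = F' ks) \<Longrightarrow> multisum S w F js = multisum S w F' js"
proof (induction js arbitrary: F F')
  case (Cons j js)
  have "multisum S w (\<lambda>ks. F (k # ks)) js = multisum S w (\<lambda>ks. F' (k # ks)) js" if "k \<in> S j" for k
    using Cons.prems that by (intro Cons.IH) auto
  then show ?case by simp
qed simp

lemma multisum_append:
  "multisum S w F (as @ bs) = multisum S w (\<lambda>ks. multisum S w (\<lambda>ls. F (ks @ ls)) bs) as"
  by (induction as arbitrary: F) auto

lemma multisum_sum: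
  "multisum S w (\<lambda>ks. \<Sum>t\<in>T. c t * F t ks) js = (\<Sum>t\<in>T. c t * multisum S w (F t) js)"
proof (induction js arbitrary: F)
  case (Cons j js)
  then show ?case
    by (simp add: sum_distrib_left, subst sum.swap) (simp add: ac_simps)
qed simp

lemma finite_choices:
  assumes "\<And>j. j \<in> set js \<Longrightarrow> finite (S j)"
  shows "finite {ks. list_all2 (\<lambda>j k. k \<in> S j) js ks}"
  using assms
proof (induction js)
  case Nil
  have "{ks. list_all2 (\<lambda>j k. k \<in> S j) [] ks} = {[]}" by auto
  then show ?case by simp
next
  case (Cons j js)
  have "{ks. list_all2 (\<lambda>j k. k \<in> S j) (j # js) ks}
      = (\<lambda>(k, ks). k # ks) ` (S j \<times> {ks. list_all2 (\<lambda>j k. k \<in> S j) js ks})"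
    by (auto simp: list_all2_Cons1 image_iff)
  then show ?case using Cons by simp
qed

lemma multisum_eq_sum:
  assumes "\<And>j. j \<in> set js \<Longrightarrow> finite (S j)"
  shows "multisum S w F js = (\<Sum>ks | list_all2 (\<lambda>j k. k \<in> S j) js ks. prod_list (map2 w js ks) * F ks)"
  using assms
proof (induction js arbitrary: F)
  case Nil
  have "{ks. list_all2 (\<lambda>j k. k \<in> S j) [] ks} = {[]}" by auto
  then show ?case by simp
next
  case (Cons j js)
  let ?A = "\<lambda>js. {ks. list_all2 (\<lambda>j k. k \<in> S j) js ks}"
  have "multisum S w F (j # js) = (\<Sum>k\<in>S j. \<Sum>ks\<in>?A js. w j k * (prod_list (map2 w js ks) * F (k # ks)))"
    using Cons by (simp add: sum_distrib_left)
  also have "\<dots> = (\<Sum>(k, ks)\<in>S j \<times> ?A js. prod_list (map2 w (j # js) (k # ks)) * F (k # ks))"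
    by (simp add: sum.cartesian_product mult.assoc)
  also have "\<dots> = (\<Sum>ks\<in>?A (j # js). prod_list (map2 w (j # js) ks) * F ks)"
    by (rule sum.reindex_bij_witness[of _ "\<lambda>ks. (hd ks, tl ks)" "\<lambda>(k, ks). k # ks"])
       (auto simp: list_all2_Cons1)
  finally show ?case .
qed

text \<open>
  A substitution of the indices by linear combinations of indices commutes with the Pfaffian, because
  the latter is linear in every index.
\<close>

lemma pf_multisum:
  "pf (\<lambda>i j. \<Sum>a\<in>S i. \<Sum>b\<in>S j. w i a * w j b * A a b) js = multisum S w (pf A) js"
proof -
  \<comment> \<open>Inr j is the linear combination that replaces j, and Inl a is the plain index a; the indices
      of the list are exchanged one after the other.\<close>
  define E where "E = (\<lambda>s t. case (s, t) of (Inl a, Inl b) \<Rightarrow> A a b | (Inl a, Inr j) \<Rightarrow> (\<Sum>b\<in>S j. w j b * A a b)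
    | (Inr i, Inl b) \<Rightarrow> (\<Sum>a\<in>S i. w i a * A a b)
    | (Inr i, Inr j) \<Rightarrow> (\<Sum>a\<in>S i. \<Sum>b\<in>S j. w i a * w j b * A a b))"
  have E [simp]: "E (Inl a) (Inl b) = A a b" "E (Inl a) (Inr j) = (\<Sum>b\<in>S j. w j b * A a b)"
    "E (Inr i) (Inl b) = (\<Sum>a\<in>S i. w i a * A a b)"
    "E (Inr i) (Inr j) = (\<Sum>a\<in>S i. \<Sum>b\<in>S j. w i a * w j b * A a b)" for a b i j
    by (simp_all add: E_def)
  have "pf E (map Inl pre @ map Inr js) = multisum S w (\<lambda>ks. pf A (pre @ ks)) js" for pre
  proof (induction js arbitrary: pre)
    case Nil
    then show ?case by (simp add: pf_map)
  next
    case (Cons j js)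
    have "pf E (map Inl pre @ Inr j # map Inr js) = (\<Sum>k\<in>S j. w j k * pf E (map Inl pre @ Inl k # map Inr js))"
    proof (rule pf_linear)
      show "E (Inr j) z = (\<Sum>t\<in>S j. w j t * E (Inl t) z)" for z
        by (cases z) (simp_all add: sum_distrib_left mult.assoc)
      show "E z (Inr j) = (\<Sum>t\<in>S j. w j t * E z (Inl t))" for z
        by (cases z) (simp_all add: sum_distrib_left mult.assoc, subst sum.swap, simp add: ac_simps)
    qed
    also have "\<dots> = (\<Sum>k\<in>S j. w j k * pf E (map Inl (pre @ [k]) @ map Inr js))"
      by simp
    finally show ?case unfolding Cons.IH by simp
  qed
  from this[of "[]"] show ?thesis by (simp add: pf_map)
qed

section \<open>Two-row functions and their Pfaffians\<close>

text \<open>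
  The coefficient of \<open>t\<^sup>r u\<^sup>s\<close> in \<open>F(t) G(u) (t - u) / (t + u)\<close>, where \<open>F\<close> and \<open>G\<close> are the generating series of
  \<open>f\<close> and \<open>g\<close>, and the quotient is expanded in powers of \<open>u / t\<close>. For \<open>f = g = q\<close> and \<open>r > s\<close> it is
  \<open>Q\<^sub>(\<^sub>r\<^sub>,\<^sub>s\<^sub>)\<close>. Two separate sequences are allowed so that each can be multiplied by a series of its own.
\<close>

definition two_row_mix :: "(nat \<Rightarrow> 'a) \<Rightarrow> (nat \<Rightarrow> 'a) \<Rightarrow> nat \<Rightarrow> nat \<Rightarrow> 'a :: comm_ring_1" where
  "two_row_mix f g r s = (\<Sum>i\<le>s. (if i = 0 then 1 else 2 * (- 1) ^ i) * f (r + i) * g (s - i))"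

abbreviation two_row :: "(nat \<Rightarrow> 'a) \<Rightarrow> nat \<Rightarrow> nat \<Rightarrow> 'a :: comm_ring_1" where
  "two_row q \<equiv> two_row_mix q q"

text \<open>
  Multiplication of the generating series of \<open>q\<close> by \<open>1 + x t\<close>.
\<close>

definition shift_add :: "'a \<Rightarrow> (nat \<Rightarrow> 'a) \<Rightarrow> nat \<Rightarrow> 'a :: comm_ring_1" where
  "shift_add x q k = (case k of 0 \<Rightarrow> q 0 | Suc j \<Rightarrow> q (Suc j) + x * q j)"

text \<open>
  The possible lengths of a row of length \<open>a\<close> after the removal of at most one box.
\<close>

definition step_down :: "nat \<Rightarrow> nat set" where
  "step_down a = {a - 1..a}"

lemma step_down_simps [simp]: "step_down 0 = {0}" "step_down (Suc a) = {a, Suc a}"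
  by (auto simp: step_down_def)

abbreviation drop_weight :: "'a \<Rightarrow> nat \<Rightarrow> nat \<Rightarrow> 'a :: comm_ring_1" where
  "drop_weight x a b \<equiv> x ^ (a - b)"

lemma two_row_mix_shift_left:
  "two_row_mix f g (Suc r) s + x * two_row_mix f g r s = two_row_mix (shift_add x f) g (Suc r) s"
  unfolding two_row_mix_def sum_distrib_left sum.distrib[symmetric]
  by (intro sum.cong) (simp_all add: shift_add_def algebra_simps)

lemma two_row_mix_shift_right:
  "two_row_mix f g r (Suc s) + x * two_row_mix f g r s = two_row_mix f (shift_add x g) r (Suc s)"
proof -
  let ?c = "\<lambda>i::nat. (if i = 0 then 1 else 2 * (- 1) ^ i) :: 'a"
  have "(\<Sum>i\<le>s. ?c i * f (r + i) * shift_add x g (Suc s - i))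
      = (\<Sum>i\<le>s. ?c i * f (r + i) * g (Suc s - i)) + (\<Sum>i\<le>s. x * (?c i * f (r + i) * g (s - i)))"
    unfolding sum.distrib[symmetric]
    by (intro sum.cong) (simp_all add: shift_add_def Suc_diff_le algebra_simps)
  then show ?thesis
    by (simp add: two_row_mix_def shift_add_def sum_distrib_left)
qed

text \<open>
  Multiplying the generating series in both variables, \<open>t\<close> and \<open>u\<close>, by \<open>1 + x t\<close> and \<open>1 + x u\<close>
  amounts to removing at most one box from each of the two rows. For \<open>s = 0\<close> there is no box to
  remove, in agreement with the absence of negative powers of \<open>u\<close>; for \<open>r = 0\<close> the coefficients of
  \<open>t\<^sup>-\<^sup>1\<close> would interfere.
\<close>

lemma two_row_strip:
  assumes "0 < r"
  shows "(\<Sum>a\<in>step_down r. \<Sum>b\<in>step_down s. drop_weight x r a * drop_weight x s b * two_row q a b)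
    = two_row (shift_add x q) r s"
proof -
  obtain r0 where r: "r = Suc r0" using assms by (cases r) auto
  have shift: "two_row_mix f (shift_add x q) r s = (\<Sum>b\<in>step_down s. drop_weight x s b * two_row_mix f q r b)" for f r
  proof (cases s)
    case (Suc s0)
    then show ?thesis using two_row_mix_shift_right[of f q r s0 x] by (simp add: add.commute)
  qed (simp add: two_row_mix_def shift_add_def)
  show ?thesis
    unfolding r two_row_mix_shift_left[symmetric] shift
    by (simp add: sum_distrib_left distrib_left sum.distrib ac_simps)
qed

lemma two_row_above_diagonal: "two_row q r (Suc r) = - two_row q (Suc r) r"
proof -
  let ?c = "\<lambda>i::nat. (if i = 0 then 1 else 2 * (- 1) ^ i) :: 'a"
  have "two_row q r (Suc r) = q r * q (Suc r) + (\<Sum>i\<le>r. ?c (Suc i) * q (Suc r + i) * q (r - i))"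
    unfolding two_row_mix_def by (simp add: sum.atMost_Suc_shift del: sum.atMost_Suc)
  also have "(\<Sum>i\<le>r. ?c (Suc i) * q (Suc r + i) * q (r - i))
      = (\<Sum>i\<le>r. (if i = 0 then - (q r * q (Suc r)) else 0) - ?c i * q (Suc r + i) * q (r - i))"
    by (intro sum.cong) (auto simp: algebra_simps)
  also have "\<dots> = - (q r * q (Suc r)) - two_row q (Suc r) r"
    by (simp add: sum_subtractf two_row_mix_def)
  finally show ?thesis by simp
qed

lemma two_row_shift_diagonal:
  "two_row (shift_add x q) (Suc r) (Suc r) = two_row q (Suc r) (Suc r) + x ^ 2 * two_row q r r"
  using two_row_strip[where r = "Suc r" and s = "Suc r" and x = x and q = q] two_row_above_diagonal[of q r]
  by (simp add: power2_eq_square algebra_simps)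

text \<open>
  The inductive step of a proof by the number of variables, which replaces the usual appeal to
  \<open>q(t) q(- t) = 1\<close>: adding a variable \<open>x\<close> preserves
  \<open>Q\<^sub>(\<^sub>r\<^sub>+\<^sub>1\<^sub>,\<^sub>r\<^sub>+\<^sub>1\<^sub>) + x\<^sup>2 Q\<^sub>(\<^sub>r\<^sub>,\<^sub>r\<^sub>)\<close>, since the mixed terms cancel by
  \<open>two_row_above_diagonal\<close>.
\<close>

lemma two_row_diagonal_step:
  assumes shift: "shift_add (- x) q' = shift_add x q"
    and diag: "\<And>r. two_row q (Suc r) (Suc r) = 0" and q: "q 0 = 1"
  shows "two_row q' (Suc r) (Suc r) = 0"
proof -
  have q': "q' 0 = 1" using fun_cong[OF shift, of 0] q by (simp add: shift_add_def)
  have *: "two_row q' (Suc r) (Suc r) + x ^ 2 * two_row q' r r = two_row q (Suc r) (Suc r) + x ^ 2 * two_row q r r" for r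
    using two_row_shift_diagonal[of "- x" q' r] two_row_shift_diagonal[of x q r] shift by simp
  show ?thesis
  proof (induction r)
    case 0
    then show ?case using *[of 0] diag[of 0] q q' by (simp add: two_row_mix_def)
  next
    case (Suc r)
    then show ?case using *[of "Suc r"] diag by simp
  qed
qed

definition pad :: "nat list \<Rightarrow> nat list" where
  "pad l = (if even (length l) then l else l @ [0])"

definition pf_two_row :: "(nat \<Rightarrow> 'a) \<Rightarrow> nat list \<Rightarrow> 'a :: comm_ring_1" where
  "pf_two_row q l = pf (two_row q) (pad l)"

lemma two_row_0_0 [simp]: "two_row_mix f g 0 0 = f 0 * g 0"
  by (simp add: two_row_mix_def)

text \<open>
  A trailing row of length 0 is harmless, even next to the zero added by \<open>pad\<close>: the two zeros pair to 1.
\<close>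

lemma pf_two_row_snoc_0:
  assumes "q 0 = 1"
  shows "pf_two_row q (l @ [0]) = pf_two_row q l"
  using pf_adjacent_equal[of "two_row q" l 0 "[]"] assms
  by (auto simp: pf_two_row_def pad_def)

lemma pf_two_row_adjacent_equal:
  assumes "\<And>r. two_row q (Suc r) (Suc r) = 0" and "0 < a"
  shows "pf_two_row q (as @ a # a # bs) = 0"
proof -
  have "two_row q a a = 0" using assms by (cases a) auto
  then show ?thesis
    using pf_adjacent_equal[of "two_row q" as a bs] pf_adjacent_equal[of "two_row q" as a "bs @ [0]"]
    by (simp add: pf_two_row_def pad_def)
qed

lemma multisum_pf_two_row:
  "multisum step_down (drop_weight x) (pf_two_row q) l
   = pf (\<lambda>r s. \<Sum>a\<in>step_down r. \<Sum>b\<in>step_down s. drop_weight x r a * drop_weight x s b * two_row q a b) (pad l)"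
proof -
  have "multisum step_down (drop_weight x) (pf_two_row q) l = multisum step_down (drop_weight x) (pf (two_row q)) (pad l)"
  proof (cases "even (length l)")
    case True
    then show ?thesis
      by (auto simp: pad_def pf_two_row_def intro!: multisum_cong dest: list_all2_lengthD)
  next
    case False
    then show ?thesis
      by (auto simp: pad_def pf_two_row_def multisum_append intro!: multisum_cong dest: list_all2_lengthD)
  qed
  then show ?thesis by (simp add: pf_multisum)
qed

lemma sorted_pad: "strict_partition l \<Longrightarrow> sorted_wrt (>) (pad l)"
  by (auto simp: strict_partition_def pad_def sorted_wrt_append)

text \<open>
  This is how the Pfaffians change when a variable \<open>x\<close> is added: \<open>q'\<close> and \<open>q\<close> stand for the
  sequences after and before, whose generating series satisfy \<open>(1 - x t) q'(t) = (1 + x t) q(t)\<close>.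
\<close>

lemma pf_two_row_strip:
  assumes "shift_add (- x) q' = shift_add x q" and "strict_partition l"
  shows "multisum step_down (drop_weight (- x)) (pf_two_row q') l = multisum step_down (drop_weight x) (pf_two_row q) l"
  unfolding multisum_pf_two_row
proof (rule pf_cong, rule sorted_wrt_mono_rel[OF _ sorted_pad[OF assms(2)]])
  fix r s :: nat assume "r > s"
  then have r: "0 < r" by simp
  show "(\<Sum>a\<in>step_down r. \<Sum>b\<in>step_down s. drop_weight (- x) r a * drop_weight (- x) s b * two_row q' a b)
    = (\<Sum>a\<in>step_down r. \<Sum>b\<in>step_down s. drop_weight x r a * drop_weight x s b * two_row q a b)"
    unfolding two_row_strip[OF r] assms(1) ..
qed

text \<open>
  The lower and upper bounds for the rows that remain when a horizontal strip is removed from a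
  shifted shape. A box may not lie directly below another one of the strip, so that a row must remain
  longer than the next row was; the last row may disappear.
\<close>

fun interlacing_bounds :: "nat list \<Rightarrow> (nat \<times> nat) list" where
  "interlacing_bounds [] = []"
| "interlacing_bounds [a] = [(0, a)]"
| "interlacing_bounds (a # b # l) = (Suc b, a) # interlacing_bounds (b # l)"

abbreviation bounded_weight :: "'a \<Rightarrow> nat \<times> nat \<Rightarrow> nat \<Rightarrow> 'a :: comm_ring_1" where
  "bounded_weight x j k \<equiv> x ^ (snd j - k)"

text \<open>
  The weights \<open>x\<^sup>a\<^sup>-\<^sup>k\<close> and \<open>1 - x S\<close>, with \<open>S\<close> the shift, are inverse to each other; cutting off the
  geometric series at \<open>b\<close> leaves one boundary term.
\<close>

lemma telescope:
  fixes f :: "nat \<Rightarrow> 'a :: comm_ring_1"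
  assumes "b \<le> a"
  shows "(\<Sum>k\<in>{Suc b..a}. x ^ (a - k) * (\<Sum>c\<in>step_down k. (- x) ^ (k - c) * f c)) = f a - x ^ (a - b) * f b"
  using assms
proof (induction a rule: dec_induct)
  case (step n)
  have "(\<Sum>k\<in>{Suc b..Suc n}. x ^ (Suc n - k) * (\<Sum>c\<in>step_down k. (- x) ^ (k - c) * f c))
     = x * (\<Sum>k\<in>{Suc b..n}. x ^ (n - k) * (\<Sum>c\<in>step_down k. (- x) ^ (k - c) * f c)) + (f (Suc n) - x * f n)"
    using step.hyps by (simp add: sum_distrib_left Suc_diff_le mult.assoc)
  also have "\<dots> = f (Suc n) - x ^ (Suc n - b) * f b"
    unfolding step.IH using step.hyps by (simp add: Suc_diff_le algebra_simps)
  finally show ?case .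
qed simp

lemma telescope_0:
  fixes f :: "nat \<Rightarrow> 'a :: comm_ring_1"
  shows "(\<Sum>k\<in>{0..a}. x ^ (a - k) * (\<Sum>c\<in>step_down k. (- x) ^ (k - c) * f c)) = f a"
  using telescope[of 0 a x f] by (simp add: sum.atLeast_Suc_atMost)

text \<open>
  Removing a horizontal strip with weight \<open>x\<close> is inverse to removing a vertical strip with
  weight \<open>- x\<close>. Row by row the sums telescope, and the boundary term of a row has two adjacent
  rows of equal positive length.
\<close>

lemma multisum_interlacing_step_down:
  assumes "strict_partition l" and "\<And>as a bs. 0 < a \<Longrightarrow> F (as @ a # a # bs) = 0"
  shows "multisum (\<lambda>(lo, a). {lo..a}) (bounded_weight x)
    (multisum step_down (drop_weight (- x)) F) (interlacing_bounds l) = F l"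
  using assms
proof (induction l arbitrary: F rule: interlacing_bounds.induct)
  case (2 a)
  then show ?case using telescope_0[of x a "\<lambda>c. F [c]"] by simp
next
  case (3 a b l)
  have sp: "strict_partition (b # l)" "0 < b" "b < a"
    using 3(2) by (auto simp: strict_partition_def)
  have IH: "multisum (\<lambda>(lo, a). {lo..a}) (bounded_weight x)
    (multisum step_down (drop_weight (- x)) (\<lambda>ks. F (c # ks))) (interlacing_bounds (b # l)) = F (c # b # l)" for c
    using 3(3)[of _ "c # as" for as] by (intro 3(1) sp) simp
  have "F (b # b # l) = 0" using 3(3)[of b "[]"] sp by simp
  then show ?case
    using telescope[of b a x "\<lambda>c. F (c # b # l)"] sp by (simp add: multisum_sum IH)
qed (simp)

section \<open>Removing the largest letter from a shifted tableau\<close>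

lemma
  assumes "T \<in> shifted_tableaux l"
  shows tableau_row: "(i, j) \<in> shifted_shape l \<Longrightarrow> (i, j') \<in> shifted_shape l \<Longrightarrow> j \<le> j' \<Longrightarrow> T (i, j) \<le> T (i, j')"
    and tableau_column: "(i, j) \<in> shifted_shape l \<Longrightarrow> (i', j) \<in> shifted_shape l \<Longrightarrow> i \<le> i' \<Longrightarrow> T (i, j) \<le> T (i', j)"
    and tableau_marked: "(i, j) \<in> shifted_shape l \<Longrightarrow> (i, j') \<in> shifted_shape l \<Longrightarrow>
      T (i, j) = Marked k \<Longrightarrow> T (i, j') = Marked k \<Longrightarrow> j = j'"
    and tableau_unmarked: "(i, j) \<in> shifted_shape l \<Longrightarrow> (i', j) \<in> shifted_shape l \<Longrightarrow>
      T (i, j) = Unmarked k \<Longrightarrow> T (i', j) = Unmarked k \<Longrightarrow> i = i'"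
    and tableau_outside: "b \<notin> shifted_shape l \<Longrightarrow> T b = undefined"
  using assms unfolding shifted_tableaux_def mem_Collect_eq
  by - (elim conjE; blast intro: PiE_arb)+

text \<open>
  Bounding the letters by their rank builds a tableau in twice as many steps as there are variables,
  one for \<open>k'\<close> and one for \<open>k\<close>.
\<close>

definition tableaux_below :: "nat \<Rightarrow> nat list \<Rightarrow> (nat \<times> nat \<Rightarrow> letter) set" where
  "tableaux_below r l = {T \<in> shifted_tableaux l. \<forall>b\<in>shifted_shape l. letter_rank (T b) < r}"

definition tableau_sum :: "(nat \<Rightarrow> 'a) \<Rightarrow> nat \<Rightarrow> nat list \<Rightarrow> 'a :: comm_ring_1" where
  "tableau_sum v r l = (\<Sum>T\<in>tableaux_below r l. \<Prod>b\<in>shifted_shape l. v (letter_index (T b)))"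

lemma finite_tableaux_below [simp, intro]: "finite (tableaux_below r l)"
proof (rule finite_subset)
  show "tableaux_below r l \<subseteq> shifted_shape l \<rightarrow>\<^sub>E letter_rank -` {..<r}"
    by (intro subsetI PiE_I) (auto simp: tableaux_below_def shifted_tableaux_def PiE_iff extensional_def)
  show "finite (shifted_shape l \<rightarrow>\<^sub>E letter_rank -` {..<r})"
    by (intro finite_PiE finite_shifted_shape finite_vimageI) (auto intro: injI letter_rank_inject)
qed

lemma shifted_shape_snoc_0: "shifted_shape (l @ [0]) = shifted_shape l"
  by (auto simp: shifted_shape_def nth_append split: if_splits)

lemma tableau_sum_snoc_0: "tableau_sum v r (l @ [0]) = tableau_sum v r l"
  unfolding tableau_sum_def tableaux_below_def shifted_tableaux_def shifted_shape_snoc_0 ..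

lemma card_shifted_shape: "card (shifted_shape l) = sum_list l"
proof -
  have "shifted_shape l = (SIGMA i:{0..<length l}. {i..<i + l ! i})"
    by (auto simp: shifted_shape_def)
  then show ?thesis by (simp add: sum_list_sum_nth)
qed

lemma sorted_gt_drop:
  assumes "sorted_wrt (>) (m :: nat list)" "i \<le> i'" "i' < length m"
  shows "m ! i' + (i' - i) \<le> m ! i"
  using assms(2,3)
proof (induction i' rule: dec_induct)
  case (step n)
  have "m ! Suc n < m ! n" using assms(1) step by (auto simp: sorted_wrt_iff_nth_less)
  then show ?case using step by simp
qed simp

lemma shifted_shape_column:
  assumes "sorted_wrt (>) m" "(i', j) \<in> shifted_shape m" "i \<le> i'"
  shows "(i, j) \<in> shifted_shape m"
  using sorted_gt_drop[OF assms(1), of i i'] assms(2,3) by (auto simp: shifted_shape_def)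

text \<open>
  The shape covered by the letters of rank less than \<open>r\<close>. It keeps the number of rows, so that its last
  entry may be 0.
\<close>

definition row_lengths :: "nat \<Rightarrow> nat list \<Rightarrow> (nat \<times> nat \<Rightarrow> letter) \<Rightarrow> nat list" where
  "row_lengths r l T = map (\<lambda>i. card {j. (i, j) \<in> shifted_shape l \<and> letter_rank (T (i, j)) < r}) [0..<length l]"

text \<open>
  The shapes that remain of \<open>l\<close> when all letters \<open>c\<close>, the largest ones, are removed: a vertical
  strip for a marked letter and a horizontal strip for an unmarked one.
\<close>

definition strip_shapes :: "letter \<Rightarrow> nat list \<Rightarrow> nat list set" where
  "strip_shapes c l = {m. length m = length l \<and> sorted_wrt (>) m \<and> (\<forall>i<length l. m ! i \<le> l ! i) \<and>
     (case c of Marked k \<Rightarrow> \<forall>i<length l. l ! i \<le> Suc (m ! i)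
      | Unmarked k \<Rightarrow> \<forall>i. Suc i < length l \<longrightarrow> l ! Suc i < m ! i)}"

definition fill_strip :: "letter \<Rightarrow> nat list \<Rightarrow> nat list \<Rightarrow> (nat \<times> nat \<Rightarrow> letter) \<Rightarrow> nat \<times> nat \<Rightarrow> letter" where
  "fill_strip c l m T b = (if b \<in> shifted_shape m then T b else if b \<in> shifted_shape l then c else undefined)"

lemma strip_shape_subset: "m \<in> strip_shapes c l \<Longrightarrow> shifted_shape m \<subseteq> shifted_shape l"
  by (fastforce simp: strip_shapes_def shifted_shape_def)

lemma initial_segment:
  fixes J :: "nat set"
  assumes "finite J" "J \<subseteq> {i..}" "\<And>j j'. j \<in> J \<Longrightarrow> i \<le> j' \<Longrightarrow> j' \<le> j \<Longrightarrow> j' \<in> J"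
  shows "J = {i..<i + card J}"
proof (cases "J = {}")
  case False
  then have M: "Max J \<in> J" using assms(1) by simp
  have "J = {i..Max J}"
  proof
    show "J \<subseteq> {i..Max J}" using assms(1,2) by (meson Max_ge atLeastAtMost_iff atLeast_iff subsetD subsetI)
    show "{i..Max J} \<subseteq> J" using assms(3)[OF M] by (meson atLeastAtMost_iff subsetI)
  qed
  moreover have "i \<le> Max J" using assms(2) M by blast
  ultimately obtain k where "J = {i..k}" "i \<le> k" by blast
  then show ?thesis by auto
qed simp

lemma shifted_shape_row_lengths:
  assumes "T \<in> shifted_tableaux l"
  shows "shifted_shape (row_lengths r l T) = {b \<in> shifted_shape l. letter_rank (T b) < r}"
proof -
  define J where "J i = {j. (i, j) \<in> shifted_shape l \<and> letter_rank (T (i, j)) < r}" for i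
  have J: "J i = {i..<i + card (J i)}" for i
  proof (rule initial_segment)
    show "finite (J i)" by (rule finite_subset[of _ "{..<i + l ! i}"]) (auto simp: J_def shifted_shape_def)
    show "J i \<subseteq> {i..}" by (auto simp: J_def shifted_shape_def)
    fix j j' assume j: "j \<in> J i" "i \<le> j'" "j' \<le> j"
    then have "(i, j') \<in> shifted_shape l" by (auto simp: J_def shifted_shape_def)
    moreover from this j have "T (i, j') \<le> T (i, j)"
      by (intro tableau_row[OF assms]) (auto simp: J_def)
    ultimately show "j' \<in> J i" using j by (auto simp: J_def less_eq_letter_def)
  qed
  have "row_lengths r l T = map (\<lambda>i. card (J i)) [0..<length l]"
    by (simp add: row_lengths_def J_def)
  then have "(i, j) \<in> shifted_shape (row_lengths r l T) \<longleftrightarrow> i < length l \<and> j \<in> {i..<i + card (J i)}" for i j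
    by (auto simp: shifted_shape_def)
  then have "(i, j) \<in> shifted_shape (row_lengths r l T) \<longleftrightarrow> i < length l \<and> j \<in> J i" for i j
    using J by blast
  then show ?thesis by (auto simp: J_def shifted_shape_def)
qed

lemma last_letter:
  assumes "T \<in> tableaux_below (Suc r) l" "letter_rank c = r" "b \<in> shifted_shape l"
    "b \<notin> shifted_shape (row_lengths r l T)"
  shows "T b = c"
proof (rule letter_rank_inject)
  have "T \<in> shifted_tableaux l" using assms by (simp add: tableaux_below_def)
  then show "letter_rank (T b) = letter_rank c"
    using assms by (auto simp: shifted_shape_row_lengths tableaux_below_def not_less less_Suc_eq)
qed

text \<open>
  That the remaining shape is again strict, apart from a last row of length 0, needs the
  conditions on the letter \<open>c\<close>: without them two adjacent rows could disappear together.
\<close>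

lemma row_lengths_strip:
  assumes l: "strict_partition l" and T: "T \<in> tableaux_below (Suc r) l" and c: "letter_rank c = r"
  shows "row_lengths r l T \<in> strip_shapes c l"
proof -
  define m where "m = row_lengths r l T"
  have T': "T \<in> shifted_tableaux l" using T by (simp add: tableaux_below_def)
  have len: "length m = length l" by (simp add: m_def row_lengths_def)
  have shape: "shifted_shape m = {b \<in> shifted_shape l. letter_rank (T b) < r}"
    unfolding m_def by (rule shifted_shape_row_lengths[OF T'])
  have le: "m ! i \<le> l ! i" if "i < length l" for i
  proof (rule ccontr)
    assume "\<not> m ! i \<le> l ! i"
    then have "(i, i + l ! i) \<in> shifted_shape m" "(i, i + l ! i) \<notin> shifted_shape l"
      using that len by (auto simp: shifted_shape_def)
    then show False using shape by auto
  qed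
  have out: "T b = c" if "b \<in> shifted_shape l" "b \<notin> shifted_shape m" for b
    using last_letter[OF T c that(1)] that(2) by (simp add: m_def)
  have l_gt: "l ! Suc i < l ! i" "0 < l ! Suc i" if "Suc i < length l" for i
    using l that by (auto simp: strict_partition_def sorted_wrt_iff_nth_less)
  have step: "m ! Suc i < m ! i" if i: "Suc i < length l" and pos: "0 < m ! i" for i
  proof (cases "m ! Suc i")
    case (Suc k)
    have a: "(Suc i, Suc i + k) \<in> shifted_shape m" using i len Suc by (simp add: shifted_shape_def)
    have b: "(i, Suc i + k) \<in> shifted_shape l"
      using i l_gt[OF i] le[OF i] Suc by (simp add: shifted_shape_def)
    have "T (i, Suc i + k) \<le> T (Suc i, Suc i + k)"
      using a b shape by (intro tableau_column[OF T']) auto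
    then have "(i, Suc i + k) \<in> shifted_shape m"
      using a b unfolding shape less_eq_letter_def by auto
    then show ?thesis using Suc by (simp add: shifted_shape_def)
  qed (use pos in simp)
  have strip: "case c of Marked k \<Rightarrow> \<forall>i<length l. l ! i \<le> Suc (m ! i)
      | Unmarked k \<Rightarrow> \<forall>i. Suc i < length l \<longrightarrow> l ! Suc i < m ! i"
  proof (cases c)
    case (Marked k)
    have "l ! i \<le> Suc (m ! i)" if i: "i < length l" for i
    proof (rule ccontr)
      assume "\<not> l ! i \<le> Suc (m ! i)"
      then have "(i, i + m ! i) \<in> shifted_shape l" "(i, Suc (i + m ! i)) \<in> shifted_shape l"
        "(i, i + m ! i) \<notin> shifted_shape m" "(i, Suc (i + m ! i)) \<notin> shifted_shape m"
        using i by (auto simp: shifted_shape_def)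
      then have "i + m ! i = Suc (i + m ! i)"
        using tableau_marked[OF T', of i _ _ k] out Marked by blast
      then show False by simp
    qed
    then show ?thesis using Marked by simp
  next
    case (Unmarked k)
    have "l ! Suc i < m ! i" if i: "Suc i < length l" for i
    proof (rule ccontr)
      assume "\<not> l ! Suc i < m ! i"
      then have n: "(i, i + l ! Suc i) \<notin> shifted_shape m" by (auto simp: shifted_shape_def)
      have b: "(i, i + l ! Suc i) \<in> shifted_shape l" "(Suc i, i + l ! Suc i) \<in> shifted_shape l"
        using i l_gt[OF i] by (auto simp: shifted_shape_def)
      then have le: "T (i, i + l ! Suc i) \<le> T (Suc i, i + l ! Suc i)"
        by (intro tableau_column[OF T']) auto
      have Tc: "T (i, i + l ! Suc i) = c" using out b n by blast
      then have "(Suc i, i + l ! Suc i) \<notin> shifted_shape m"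
        using le c by (auto simp: shape less_eq_letter_def)
      then have "T (Suc i, i + l ! Suc i) = c" using out b by blast
      then have "i = Suc i"
        using Tc b Unmarked by (intro tableau_unmarked[OF T', of i _ "Suc i" k]) auto
      then show False by simp
    qed
    then show ?thesis using Unmarked by simp
  qed
  have pos: "0 < m ! i" if i: "Suc i < length l" for i
    using strip l_gt[OF i] i by (cases c) (auto dest!: spec[of _ i])
  have "sorted_wrt (>) m"
    using step pos len by (subst sorted_wrt_iff_nth_Suc_transp) auto
  then show ?thesis
    using len le strip by (simp add: strip_shapes_def flip: m_def)
qed

lemma restrict_tableau:
  assumes "T \<in> shifted_tableaux l" "shifted_shape m \<subseteq> shifted_shape l"
  shows "restrict T (shifted_shape m) \<in> shifted_tableaux m"
proof -
  have sub: "b \<in> shifted_shape l" if "b \<in> shifted_shape m" for b using assms(2) that by blast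
  note T = tableau_row[OF assms(1)] tableau_column[OF assms(1)] tableau_marked[OF assms(1)] tableau_unmarked[OF assms(1)]
  show ?thesis
    unfolding shifted_tableaux_def mem_Collect_eq
  proof (intro conjI allI impI)
    show "j = j'" if "(i, j) \<in> shifted_shape m" "(i, j') \<in> shifted_shape m"
      "restrict T (shifted_shape m) (i, j) = Marked k" "restrict T (shifted_shape m) (i, j') = Marked k" for k i j j'
      using that sub by (intro T(3)[of i j j' k]) auto
    show "i = i'" if "(i, j) \<in> shifted_shape m" "(i', j) \<in> shifted_shape m"
      "restrict T (shifted_shape m) (i, j) = Unmarked k" "restrict T (shifted_shape m) (i', j) = Unmarked k" for k i i' j
      using that sub by (intro T(4)[of i j i' k]) auto
  qed (use sub T(1,2) in auto)
qed

lemma fill_strip_tableau: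
  assumes l: "strict_partition l" and m: "m \<in> strip_shapes c l" and T: "T \<in> tableaux_below r m"
    and c: "letter_rank c = r"
  shows "fill_strip c l m T \<in> tableaux_below (Suc r) l"
proof -
  let ?F = "fill_strip c l m T"
  have sub: "shifted_shape m \<subseteq> shifted_shape l" by (rule strip_shape_subset[OF m])
  have rank: "letter_rank (T b) < r" if "b \<in> shifted_shape m" for b
    using T that by (auto simp: tableaux_below_def)
  have T': "T \<in> shifted_tableaux m" using T by (auto simp: tableaux_below_def)
  have inside: "?F b = T b" if "b \<in> shifted_shape m" for b using that by (simp add: fill_strip_def)
  have outside: "?F b = c" if "b \<in> shifted_shape l" "b \<notin> shifted_shape m" for b
    using that by (simp add: fill_strip_def)
  have below: "?F b \<le> c" if "b \<in> shifted_shape l" for b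
    using that rank[of b] c inside outside by (cases "b \<in> shifted_shape m") (auto simp: less_eq_letter_def)
  have eq_c: "b \<notin> shifted_shape m" if "?F b = c" "b \<in> shifted_shape l" for b
    using that rank[of b] c inside[of b] by auto
  have sorted: "sorted_wrt (>) l" "sorted_wrt (>) m" and len: "length m = length l"
    using l m by (auto simp: strict_partition_def strip_shapes_def)
  have rows: "?F (i, j) \<le> ?F (i, j')"
    if "(i, j) \<in> shifted_shape l" "(i, j') \<in> shifted_shape l" "j \<le> j'" for i j j'
  proof (cases "(i, j') \<in> shifted_shape m")
    case True
    then have "(i, j) \<in> shifted_shape m" using that by (auto simp: shifted_shape_def)
    then show ?thesis using True that inside tableau_row[OF T'] by auto
  qed (use that outside below in auto)
  have columns: "?F (i, j) \<le> ?F (i', j)"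
    if "(i, j) \<in> shifted_shape l" "(i', j) \<in> shifted_shape l" "i \<le> i'" for i i' j
  proof (cases "(i', j) \<in> shifted_shape m")
    case True
    then have "(i, j) \<in> shifted_shape m" using that sorted shifted_shape_column by blast
    then show ?thesis using True that inside tableau_column[OF T'] by auto
  qed (use that outside below in auto)
  have marked: "j = j'"
    if "(i, j) \<in> shifted_shape l" "(i, j') \<in> shifted_shape l" "?F (i, j) = Marked k" "?F (i, j') = Marked k"
    for i j j' k
  proof (cases "c = Marked k")
    case True
    then have "(i, j) \<notin> shifted_shape m" "(i, j') \<notin> shifted_shape m" using that eq_c by auto
    moreover have "l ! i \<le> Suc (m ! i)"
      using m True that by (auto simp: strip_shapes_def shifted_shape_def)
    ultimately show ?thesis using that len by (auto simp: shifted_shape_def)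
  next
    case False
    then have "(i, j) \<in> shifted_shape m" "(i, j') \<in> shifted_shape m" using that outside by metis+
    then show ?thesis using that inside tableau_marked[OF T', of i j j' k] by auto
  qed
  have unmarked_less: False
    if b: "(i, j) \<in> shifted_shape l" "(i', j) \<in> shifted_shape l" and "?F (i, j) = c" and i: "i < i'"
      and "c = Unmarked k" for i i' j k
  proof -
    have "(i, j) \<notin> shifted_shape m" using that eq_c by auto
    then have "i + m ! i \<le> j" using b len by (auto simp: shifted_shape_def)
    moreover have "l ! Suc i < m ! i" "l ! i' + (i' - Suc i) \<le> l ! Suc i"
      using m that sorted_gt_drop[OF sorted(1), of "Suc i" i'] by (auto simp: strip_shapes_def shifted_shape_def)
    ultimately show False using b i by (auto simp: shifted_shape_def)
  qed
  have unmarked: "i = i'"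
    if b: "(i, j) \<in> shifted_shape l" "(i', j) \<in> shifted_shape l" "?F (i, j) = Unmarked k" "?F (i', j) = Unmarked k"
    for i i' j k
  proof (cases "c = Unmarked k")
    case True
    then show ?thesis
      using unmarked_less[of i j i' k] unmarked_less[of i' j i k] b by (metis linorder_neqE_nat)
  next
    case False
    then have "(i, j) \<in> shifted_shape m" "(i', j) \<in> shifted_shape m" using that outside by metis+
    then show ?thesis using that inside tableau_unmarked[OF T', of i j i' k] by auto
  qed
  have "?F \<in> shifted_shape l \<rightarrow>\<^sub>E UNIV"
    using sub by (auto simp: fill_strip_def PiE_iff extensional_def)
  then have "?F \<in> shifted_tableaux l"
    unfolding shifted_tableaux_def using rows columns marked unmarked by blast
  then show ?thesis
    using below c by (auto simp: tableaux_below_def less_eq_letter_def less_Suc_eq_le)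
qed

lemma row_lengths_fill_strip:
  assumes "m \<in> strip_shapes c l" and "T \<in> tableaux_below r m" and "letter_rank c = r"
  shows "row_lengths r l (fill_strip c l m T) = m"
proof (rule nth_equalityI)
  show "length (row_lengths r l (fill_strip c l m T)) = length m"
    using assms by (simp add: row_lengths_def strip_shapes_def)
  fix i assume "i < length (row_lengths r l (fill_strip c l m T))"
  then have i: "i < length l" by (simp add: row_lengths_def)
  have "{j. (i, j) \<in> shifted_shape l \<and> letter_rank (fill_strip c l m T (i, j)) < r} = {i..<i + m ! i}"
    using assms strip_shape_subset[OF assms(1)] i
    by (auto simp: fill_strip_def tableaux_below_def strip_shapes_def)
       (auto simp: shifted_shape_def split: if_splits)
  then show "row_lengths r l (fill_strip c l m T) ! i = m ! i"
    using i by (simp add: row_lengths_def)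
qed

theorem tableau_sum_Suc:
  assumes l: "strict_partition l" and c: "letter_rank c = r"
  shows "tableau_sum v (Suc r) l
    = (\<Sum>m\<in>strip_shapes c l. v (letter_index c) ^ (sum_list l - sum_list m) * tableau_sum v r m)"
proof -
  have fin: "finite (strip_shapes c l)"
    by (rule finite_subset[OF _ finite_choices[of l "\<lambda>a. {..a}"]])
       (auto simp: strip_shapes_def list_all2_conv_all_nth)
  let ?g = "\<lambda>T. \<Prod>b\<in>shifted_shape l. v (letter_index (T b))"
  let ?h = "\<lambda>m T. v (letter_index c) ^ (sum_list l - sum_list m) * (\<Prod>b\<in>shifted_shape m. v (letter_index (T b)))"
  have "(\<Sum>T\<in>tableaux_below (Suc r) l. ?g T) = (\<Sum>(m, T)\<in>Sigma (strip_shapes c l) (tableaux_below r). ?h m T)"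
  proof (rule sum.reindex_bij_witness[where j = "\<lambda>T. (row_lengths r l T, restrict T (shifted_shape (row_lengths r l T)))"
        and i = "\<lambda>(m, T). fill_strip c l m T"])
    fix T assume T: "T \<in> tableaux_below (Suc r) l"
    let ?m = "row_lengths r l T"
    have m: "?m \<in> strip_shapes c l" by (rule row_lengths_strip[OF l T c])
    note sub = strip_shape_subset[OF m]
    have T': "T \<in> shifted_tableaux l" using T by (simp add: tableaux_below_def)
    have out: "T b = c" if "b \<in> shifted_shape l - shifted_shape ?m" for b
      using last_letter[OF T c] that by auto
    have undef: "T b = undefined" if "b \<notin> shifted_shape l" for b
      by (rule tableau_outside[OF T' that])
    show "(case (?m, restrict T (shifted_shape ?m)) of (m, T) \<Rightarrow> fill_strip c l m T) = T"
      using out undef by (auto simp: fill_strip_def)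
    show "(?m, restrict T (shifted_shape ?m)) \<in> Sigma (strip_shapes c l) (tableaux_below r)"
      using m restrict_tableau[OF T' sub] shifted_shape_row_lengths[OF T', of r]
      by (auto simp: tableaux_below_def)
    have "?g T = (\<Prod>b\<in>shifted_shape ?m. v (letter_index (T b))) * (\<Prod>b\<in>shifted_shape l - shifted_shape ?m. v (letter_index (T b)))"
      by (rule prod.subset_diff[OF sub, THEN trans]) (simp_all add: mult.commute)
    also have "(\<Prod>b\<in>shifted_shape l - shifted_shape ?m. v (letter_index (T b))) = v (letter_index c) ^ (sum_list l - sum_list ?m)"
      using sub by (simp add: out card_Diff_subset card_shifted_shape)
    finally show "(case (?m, restrict T (shifted_shape ?m)) of (m, T) \<Rightarrow> ?h m T) = ?g T"
      by (simp add: mult.commute)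
  next
    fix p assume "p \<in> Sigma (strip_shapes c l) (tableaux_below r)"
    then obtain m T where p: "p = (m, T)" and m: "m \<in> strip_shapes c l" and T: "T \<in> tableaux_below r m" by auto
    have "restrict (fill_strip c l m T) (shifted_shape m) = T"
    proof
      fix b
      show "restrict (fill_strip c l m T) (shifted_shape m) b = T b"
        using T tableau_outside[of T m b] by (auto simp: fill_strip_def tableaux_below_def)
    qed
    then show "(row_lengths r l (case p of (m, T) \<Rightarrow> fill_strip c l m T),
        restrict (case p of (m, T) \<Rightarrow> fill_strip c l m T)
          (shifted_shape (row_lengths r l (case p of (m, T) \<Rightarrow> fill_strip c l m T)))) = p"
      using row_lengths_fill_strip[OF m T c] by (simp add: p)
    show "(case p of (m, T) \<Rightarrow> fill_strip c l m T) \<in> tableaux_below (Suc r) l"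
      using fill_strip_tableau[OF l m T c] by (simp add: p)
  qed
  also have "\<dots> = (\<Sum>m\<in>strip_shapes c l. \<Sum>T\<in>tableaux_below r m. ?h m T)"
    by (rule sum.Sigma[symmetric]) (use fin in auto)
  finally show ?thesis
    by (simp add: tableau_sum_def sum_distrib_left)
qed

section \<open>The Pfaffian formula for tableaux with finitely many letters\<close>

lemma strict_or_snoc_0:
  assumes "sorted_wrt (>) (m :: nat list)"
  obtains "strict_partition m" | l where "strict_partition l" "m = l @ [0]"
proof (cases "0 \<in> set m")
  case True
  then obtain l l' where m: "m = l @ 0 # l'" by (meson split_list)
  with assms have "l' = []" by (cases l') (auto simp: sorted_wrt_append)
  with m assms have "strict_partition l" "m = l @ [0]"
    by (auto simp: strict_partition_def sorted_wrt_append)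
  then show ?thesis using that(2) by blast
next
  case False
  then have "strict_partition m" using assms by (auto simp: strict_partition_def intro: gr0I)
  then show ?thesis using that(1) by blast
qed

lemma prod_drop_weight:
  assumes "list_all2 (\<lambda>a k. k \<le> a) l m"
  shows "prod_list (map2 (drop_weight x) l m) = x ^ (sum_list l - sum_list m) \<and> sum_list m \<le> sum_list l"
  using assms
proof (induction rule: list_all2_induct)
  case (Cons a l k m)
  then have "a + sum_list l - (k + sum_list m) = (a - k) + (sum_list l - sum_list m)" by simp
  with Cons show ?case by (simp add: power_add[symmetric] del: diff_diff_left)
qed simp

lemma length_interlacing_bounds [simp]: "length (interlacing_bounds l) = length l"
  by (induction l rule: interlacing_bounds.induct) auto

lemma nth_interlacing_bounds:
  "i < length l \<Longrightarrow> interlacing_bounds l ! i = (if Suc i < length l then Suc (l ! Suc i) else 0, l ! i)"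
proof (induction l arbitrary: i rule: interlacing_bounds.induct)
  case (3 a b l)
  then show ?case by (cases i) auto
qed auto

lemma strip_shapes_Marked:
  "strip_shapes (Marked k) l = {m. list_all2 (\<lambda>a k. k \<in> step_down a) l m} \<inter> {m. sorted_wrt (>) m}"
  by (auto simp: strip_shapes_def list_all2_conv_all_nth step_down_def)

lemma strip_shapes_Unmarked:
  assumes "strict_partition l"
  shows "strip_shapes (Unmarked k) l
    = {m. list_all2 (\<lambda>j k. k \<in> (case j of (lo, a) \<Rightarrow> {lo..a})) (interlacing_bounds l) m}" (is "_ = ?R")
proof
  show "strip_shapes (Unmarked k) l \<subseteq> ?R"
    by (auto simp: strip_shapes_def list_all2_conv_all_nth nth_interlacing_bounds Suc_le_eq)
  show "?R \<subseteq> strip_shapes (Unmarked k) l"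
  proof
    fix m assume m: "m \<in> ?R"
    then have len: "length m = length l" by (auto dest: list_all2_lengthD)
    have le: "m ! i \<le> l ! i" and gt: "Suc i < length l \<Longrightarrow> l ! Suc i < m ! i" if "i < length l" for i
      using m that by (auto simp: list_all2_conv_all_nth nth_interlacing_bounds Suc_le_eq split: if_splits)
    have "m ! Suc i < m ! i" if "Suc i < length l" for i
      using gt[of i] le[of "Suc i"] that by simp
    then have "sorted_wrt (>) m"
      using len by (subst sorted_wrt_iff_nth_Suc_transp) auto
    then show "m \<in> strip_shapes (Unmarked k) l"
      using len le gt by (simp add: strip_shapes_def)
  qed
qed

text \<open>
  For a vertical strip the choices in the rows are independent except that the result has to be
  strict; the sum over all choices is restored by letting the other shapes contribute 0.
\<close>

lemma tableau_sum_Marked: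
  assumes "strict_partition l"
  shows "tableau_sum v (Suc (2 * k)) l
    = multisum step_down (drop_weight (v k)) (\<lambda>m. if sorted_wrt (>) m then tableau_sum v (2 * k) m else 0) l"
proof -
  let ?S = "{m. list_all2 (\<lambda>a k. k \<in> step_down a) l m}"
  have fin: "finite (step_down a)" for a by (simp add: step_down_def)
  have finS: "finite ?S" using fin by (intro finite_choices)
  have weight: "prod_list (map2 (drop_weight (v k)) l m) = v k ^ (sum_list l - sum_list m)" if "m \<in> ?S" for m
  proof -
    have "list_all2 (\<lambda>a k. k \<le> a) l m"
      using that by (auto simp: step_down_def elim: list_all2_mono)
    then show ?thesis using prod_drop_weight by blast
  qed
  have "tableau_sum v (Suc (2 * k)) l
      = (\<Sum>m\<in>?S \<inter> {m. sorted_wrt (>) m}. v k ^ (sum_list l - sum_list m) * tableau_sum v (2 * k) m)"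
    using tableau_sum_Suc[OF assms, of "Marked k" "2 * k" v] by (simp add: strip_shapes_Marked)
  also have "\<dots> = (\<Sum>m\<in>?S. v k ^ (sum_list l - sum_list m) * (if sorted_wrt (>) m then tableau_sum v (2 * k) m else 0))"
    using finS by (simp add: sum.inter_restrict if_distrib cong: if_cong)
  also have "\<dots> = multisum step_down (drop_weight (v k)) (\<lambda>m. if sorted_wrt (>) m then tableau_sum v (2 * k) m else 0) l"
    using fin by (simp add: multisum_eq_sum weight)
  finally show ?thesis .
qed

lemma tableau_sum_Unmarked:
  assumes "strict_partition l"
  shows "tableau_sum v (Suc (Suc (2 * k))) l
    = multisum (\<lambda>(lo, a). {lo..a}) (bounded_weight (v k)) (tableau_sum v (Suc (2 * k))) (interlacing_bounds l)"
proof -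
  let ?S = "strip_shapes (Unmarked k) l"
  have weight: "prod_list (map2 (bounded_weight (v k)) (interlacing_bounds l) m) = v k ^ (sum_list l - sum_list m)"
    if m: "m \<in> ?S" for m
  proof -
    have len: "length m = length l" using m by (simp add: strip_shapes_def)
    have "list_all2 (\<lambda>a k. k \<le> a) l m"
      using m by (auto simp: strip_shapes_def list_all2_conv_all_nth)
    moreover have "map2 (bounded_weight (v k)) (interlacing_bounds l) m = map2 (drop_weight (v k)) l m"
      using len by (intro nth_equalityI) (auto simp: nth_interlacing_bounds)
    ultimately show ?thesis using prod_drop_weight by metis
  qed
  have "tableau_sum v (Suc (Suc (2 * k))) l
      = (\<Sum>m\<in>?S. v k ^ (sum_list l - sum_list m) * tableau_sum v (Suc (2 * k)) m)"
    using tableau_sum_Suc[OF assms, of "Unmarked k" "Suc (2 * k)" v] by simp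
  also have "\<dots> = (\<Sum>m\<in>?S. prod_list (map2 (bounded_weight (v k)) (interlacing_bounds l) m) * tableau_sum v (Suc (2 * k)) m)"
    by (simp add: weight)
  also have "\<dots> = multisum (\<lambda>(lo, a). {lo..a}) (bounded_weight (v k)) (tableau_sum v (Suc (2 * k))) (interlacing_bounds l)"
    unfolding strip_shapes_Unmarked[OF assms] by (rule multisum_eq_sum[symmetric]) auto
  finally show ?thesis .
qed

text \<open>
  A choice excluded from a vertical strip produces equal adjacent rows, where the Pfaffian
  vanishes as well.
\<close>

lemma not_sorted_step_down:
  assumes l: "strict_partition l" and m: "list_all2 (\<lambda>a k. k \<in> step_down a) l m" and "\<not> sorted_wrt (>) m"
  obtains as a bs where "m = as @ a # a # bs" "0 < a"
proof -
  have len: "length m = length l" and m': "\<And>i. i < length l \<Longrightarrow> l ! i - 1 \<le> m ! i \<and> m ! i \<le> l ! i"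
    using m by (auto simp: list_all2_conv_all_nth step_down_def)
  obtain i where i: "Suc i < length m" "m ! i \<le> m ! Suc i"
    using assms(3) by (subst (asm) sorted_wrt_iff_nth_Suc_transp) (auto simp: not_less)
  have "l ! Suc i < l ! i" "0 < l ! Suc i"
    using l i len by (auto simp: strict_partition_def sorted_wrt_iff_nth_less)
  then have "m ! i = m ! Suc i" "0 < m ! i" using m'[of i] m'[of "Suc i"] i len by auto
  moreover have "m = take i m @ m ! i # m ! Suc i # drop (Suc (Suc i)) m"
    using i by (metis Cons_nth_drop_Suc Suc_lessD append_take_drop_id)
  ultimately show ?thesis using that by metis
qed

text \<open>
  Induction on the number of variables. The marked letter turns the Pfaffians for \<open>n\<close> variables into
  \<open>W\<close>, the image of the Pfaffians for \<open>n + 1\<close> variables under the removal of vertical strips with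
  weight \<open>- x\<close>, and the unmarked letter undoes this removal.
\<close>

theorem tableau_sum_eq_pf:
  fixes v :: "nat \<Rightarrow> 'a :: comm_ring_1"
  assumes q0: "q 0 = (\<lambda>k. if k = 0 then 1 else 0)"
    and q: "\<And>n. shift_add (- v n) (q (Suc n)) = shift_add (v n) (q n)"
    and l: "strict_partition l"
  shows "tableau_sum v (2 * n) l = pf_two_row (q n) l"
proof -
  have one: "q n 0 = 1" for n
  proof (induction n)
    case (Suc n)
    then show ?case using fun_cong[OF q[of n], of 0] by (simp add: shift_add_def)
  qed (simp add: q0)
  have diag: "two_row (q n) (Suc r) (Suc r) = 0" for n r
  proof (induction n arbitrary: r)
    case (Suc n)
    then show ?case using two_row_diagonal_step[OF q _ one] by blast
  qed (simp add: q0 two_row_mix_def)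
  show ?thesis
    using l
  proof (induction n arbitrary: l)
    case 0
    show ?case
    proof (cases l)
      case Nil
      have "tableaux_below 0 [] = {\<lambda>_. undefined}"
        by (auto simp: tableaux_below_def shifted_tableaux_def shifted_shape_def)
      then show ?thesis
        by (simp add: Nil tableau_sum_def pf_two_row_def pad_def shifted_shape_def)
    next
      case (Cons a l')
      then have a: "0 < a" using 0 by (simp add: strict_partition_def)
      then have "(0, 0) \<in> shifted_shape l" by (simp add: Cons shifted_shape_def)
      then have "tableaux_below 0 l = {}" by (auto simp: tableaux_below_def)
      moreover have "two_row (q 0) a b = 0" for b using a by (simp add: q0 two_row_mix_def)
      ultimately show ?thesis
        by (simp add: Cons tableau_sum_def pf_two_row_def pad_def pf_Cons)
    qed
  next
    case (Suc n)
    define W where "W = multisum step_down (drop_weight (- v n)) (pf_two_row (q (Suc n)))"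
    have IH: "tableau_sum v (2 * n) m = pf_two_row (q n) m" if "sorted_wrt (>) m" for m
      using that
      by (rule strict_or_snoc_0) (simp_all add: Suc.IH tableau_sum_snoc_0 pf_two_row_snoc_0 one)
    have marked: "tableau_sum v (Suc (2 * n)) l = W l" if l: "strict_partition l" for l
    proof -
      have "(if sorted_wrt (>) m then tableau_sum v (2 * n) m else 0) = pf_two_row (q n) m"
        if m: "list_all2 (\<lambda>a k. k \<in> step_down a) l m" for m
      proof (cases "sorted_wrt (>) m")
        case False
        then obtain as a bs where "m = as @ a # a # bs" "0 < a"
          by (rule not_sorted_step_down[OF l m])
        then have "pf_two_row (q n) m = 0" by (simp add: pf_two_row_adjacent_equal diag)
        then show ?thesis using False by simp
      qed (simp add: IH)
      then have "tableau_sum v (Suc (2 * n)) l = multisum step_down (drop_weight (v n)) (pf_two_row (q n)) l"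
        unfolding tableau_sum_Marked[OF l] by (rule multisum_cong)
      then show ?thesis unfolding W_def pf_two_row_strip[OF q l] .
    qed
    have W0: "W (l @ [0]) = W l" for l
      by (simp add: W_def multisum_append pf_two_row_snoc_0 one)
    have marked': "tableau_sum v (Suc (2 * n)) m = W m" if "sorted_wrt (>) m" for m
      using that by (rule strict_or_snoc_0) (simp_all add: marked tableau_sum_snoc_0 W0)
    have "tableau_sum v (Suc (Suc (2 * n))) l = multisum (\<lambda>(lo, a). {lo..a}) (bounded_weight (v n)) W (interlacing_bounds l)"
      unfolding tableau_sum_Unmarked[OF Suc.prems]
    proof (rule multisum_cong)
      fix m assume "list_all2 (\<lambda>j k. k \<in> (case j of (lo, a) \<Rightarrow> {lo..a})) (interlacing_bounds l) m"
      then have "m \<in> strip_shapes (Unmarked n) l" by (simp add: strip_shapes_Unmarked[OF Suc.prems])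
      then show "tableau_sum v (Suc (2 * n)) m = W m" by (simp add: marked' strip_shapes_def)
    qed
    also have "\<dots> = pf_two_row (q (Suc n)) l"
      unfolding W_def
      by (rule multisum_interlacing_step_down[OF Suc.prems]) (simp add: pf_two_row_adjacent_equal diag)
    finally show ?case by simp
  qed
qed

section \<open>The Pfaffian formula for Schur Q-functions\<close>

definition finite_schur_q :: "(nat \<Rightarrow> 'v) \<Rightarrow> nat \<Rightarrow> nat \<Rightarrow> 'v mps" where
  "finite_schur_q x n k = fps_nth (\<Prod>i<n. q_factor (x i)) k"

lemma shift_add_fps_nth: "shift_add c (fps_nth F) k = fps_nth (F * (1 + fps_X * fps_const c)) k"
proof -
  have "F * (1 + fps_X * fps_const c) = F + fps_X * (fps_const c * F)"
    by (simp add: algebra_simps)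
  then show ?thesis by (cases k) (simp_all add: shift_add_def)
qed

lemma finite_schur_q_shift:
  "shift_add (- mps_var (x n)) (finite_schur_q x (Suc n)) = shift_add (mps_var (x n)) (finite_schur_q x n)"
proof
  fix k
  let ?F = "\<Prod>i<n. q_factor (x i)" and ?c = "fps_X * fps_const (mps_var (x n))"
  have "?F * q_factor (x n) * (1 - ?c) = ?F * (1 + ?c)"
    unfolding q_factor_correct[symmetric] by (simp only: mult.assoc)
  moreover have "1 - ?c = 1 + fps_X * fps_const (- mps_var (x n))"
    by (simp flip: fps_const_neg)
  moreover have "finite_schur_q x n = fps_nth ?F" "finite_schur_q x (Suc n) = fps_nth (?F * q_factor (x n))"
    by (auto simp: finite_schur_q_def)
  ultimately show "shift_add (- mps_var (x n)) (finite_schur_q x (Suc n)) k = shift_add (mps_var (x n)) (finite_schur_q x n) k"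
    by (simp only: shift_add_fps_nth)
qed

text \<open>
  Equality modulo the ideal of the series without monomials dividing \<open>m\<close>. A given coefficient of
  an infinite sequence of variables is reduced in this way to finitely many variables.
\<close>

definition agree_upto :: "'v multiset \<Rightarrow> 'v mps \<Rightarrow> 'v mps \<Rightarrow> bool" where
  "agree_upto m f g \<longleftrightarrow> (\<forall>a. a \<subseteq># m \<longrightarrow> mps_coeff f a = mps_coeff g a)"

lemma agree_refl [simp]: "agree_upto m f f"
  by (simp add: agree_upto_def)

lemma agree_mult: "agree_upto m f f' \<Longrightarrow> agree_upto m g g' \<Longrightarrow> agree_upto m (f * g) (f' * g')"
  unfolding agree_upto_def mps_coeff_mult splits_def
  by (auto intro!: sum.cong simp: subset_mset.add_increasing)
     (metis mset_subset_eq_add_left mset_subset_eq_add_right subset_mset.order_trans)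

lemma agree_sum: "(\<And>i. i \<in> A \<Longrightarrow> agree_upto m (f i) (g i)) \<Longrightarrow> agree_upto m (sum f A) (sum g A)"
  by (auto simp: agree_upto_def intro!: sum.cong)

lemma agree_pf:
  assumes "\<And>a b. agree_upto m (M a b) (M' a b)"
  shows "agree_upto m (pf M xs) (pf M' xs)"
proof (induction "length xs" arbitrary: xs rule: less_induct)
  case less
  show ?case
  proof (cases xs)
    case (Cons a ys)
    then show ?thesis
      unfolding Cons pf_Cons
      by (intro agree_sum agree_mult agree_refl assms less.hyps) (simp add: Cons length_drop_nth)
  qed simp
qed

lemma agree_finite_schur_q:
  assumes "inj x" and N: "\<And>i. x i \<in># m \<Longrightarrow> i < N"
  shows "agree_upto m (finite_schur_q x N k) (schur_q x k)"
  unfolding agree_upto_def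
proof (intro allI impI)
  fix a assume a: "a \<subseteq># m"
  have zero: "mps_coeff (f * mps_var (x n)) a = 0" if "N \<le> n" for f n
  proof -
    have "x n \<notin># a" using N[of n] that a by (auto dest: mset_subset_eqD)
    then show ?thesis using mps_coeff_var_mult_eq_0[of "x n" a f 0] by simp
  qed
  have step: "mps_coeff (finite_schur_q x (Suc n) k) a = mps_coeff (finite_schur_q x n k) a" if "N \<le> n" for n
  proof (cases k)
    case 0
    then show ?thesis using fun_cong[OF finite_schur_q_shift[of x n], of 0] by (simp add: shift_add_def)
  next
    case (Suc j)
    then have "finite_schur_q x (Suc n) k = finite_schur_q x n k
        + (finite_schur_q x n j + finite_schur_q x (Suc n) j) * mps_var (x n)"
      using fun_cong[OF finite_schur_q_shift[of x n], of k]
      by (simp add: shift_add_def algebra_simps eq_diff_eq)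
    then show ?thesis using zero[OF that] by simp
  qed
  have const: "mps_coeff (finite_schur_q x n k) a = mps_coeff (finite_schur_q x N k) a" if "N \<le> n" for n
    using that by (induction n rule: dec_induct) (simp_all add: step)
  obtain N' where "\<And>n. n \<ge> N' \<Longrightarrow> mps_coeff (finite_schur_q x n k) a = mps_coeff (schur_q x k) a"
    using eventually_schur_q_coeff[OF assms(1), of k a]
    unfolding eventually_sequentially finite_schur_q_def by blast
  then show "mps_coeff (finite_schur_q x N k) a = mps_coeff (schur_q x k) a"
    using const[of "max N N'"] by simp
qed

definition mps_monomial :: "'v multiset \<Rightarrow> 'v mps" where
  "mps_monomial a = Abs_mps (\<lambda>m. if m = a then 1 else 0)"

lemma mps_monomial_add: "mps_monomial (a + b) = mps_monomial a * mps_monomial b"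
proof (rule mps_eqI)
  fix m
  have "mps_coeff (mps_monomial a * mps_monomial b) m = (\<Sum>p\<in>splits m. if p = (a, b) then 1 else 0)"
    unfolding mps_coeff_mult by (intro sum.cong) (auto simp: mps_monomial_def split: if_splits)
  also have "\<dots> = (if (a, b) \<in> splits m then 1 else 0)" by simp
  finally show "mps_coeff (mps_monomial (a + b)) m = mps_coeff (mps_monomial a * mps_monomial b) m"
    by (auto simp: mps_monomial_def splits_def)
qed

lemma prod_mps_var:
  "finite A \<Longrightarrow> (\<Prod>b\<in>A. mps_var (g b)) = mps_monomial (image_mset g (mset_set A))"
proof (induction A rule: finite_induct)
  case empty
  show ?case by (rule mps_eqI) (simp add: mps_monomial_def)
next
  case (insert b A)
  have "mps_var (g b) = mps_monomial {#g b#}" by (simp add: mps_var_def mps_monomial_def)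
  then show ?case using insert mps_monomial_add[of "{#g b#}" "image_mset g (mset_set A)"] by simp
qed

lemma mps_coeff_tableau_sum:
  assumes N: "\<And>i. x i \<in># m \<Longrightarrow> i < N"
  shows "mps_coeff (tableau_sum (\<lambda>i. mps_var (x i)) (2 * N) l) m = mps_coeff (schur_Q x l) m"
proof -
  have "{T \<in> tableaux_below (2 * N) l. tableau_monomial x l T = m} = {T \<in> shifted_tableaux l. tableau_monomial x l T = m}"
  proof -
    have "letter_rank (T b) < 2 * N" if "tableau_monomial x l T = m" "b \<in> shifted_shape l" for T b
    proof -
      have "x (letter_index (T b)) \<in># m" using that by (auto simp: tableau_monomial_def)
      then show ?thesis using N by (cases "T b") fastforce+
    qed
    then show ?thesis by (auto simp: tableaux_below_def)
  qed
  moreover have "mps_coeff (tableau_sum (\<lambda>i. mps_var (x i)) (2 * N) l) m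
      = (\<Sum>T\<in>tableaux_below (2 * N) l. if tableau_monomial x l T = m then 1 else 0)"
    unfolding tableau_sum_def mps_coeff_sum
    by (intro sum.cong) (auto simp: prod_mps_var mps_monomial_def tableau_monomial_def)
  ultimately show ?thesis
    by (simp add: schur_Q_def sum.If_cases Int_def)
qed

theorem schur_Q_eq_pf:
  assumes x: "inj x" and l: "strict_partition l"
  shows "schur_Q x l = pf_two_row (schur_q x) l"
proof (rule mps_eqI)
  fix m
  have "finite (x -` set_mset m)" using x by (intro finite_vimageI) auto
  then obtain N where N: "\<And>i. x i \<in># m \<Longrightarrow> i < N"
    by (metis finite_nat_bounded lessThan_iff subsetD vimageI)
  have "mps_coeff (schur_Q x l) m = mps_coeff (tableau_sum (\<lambda>i. mps_var (x i)) (2 * N) l) m"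
    using mps_coeff_tableau_sum[of x m N l] N by simp
  also have "tableau_sum (\<lambda>i. mps_var (x i)) (2 * N) l = pf_two_row (finite_schur_q x N) l"
    using l by (intro tableau_sum_eq_pf finite_schur_q_shift) (auto simp: finite_schur_q_def)
  also have "mps_coeff \<dots> m = mps_coeff (pf_two_row (schur_q x) l) m"
  proof -
    have "agree_upto m (pf_two_row (finite_schur_q x N) l) (pf_two_row (schur_q x) l)"
      unfolding pf_two_row_def two_row_mix_def
      by (intro agree_pf agree_sum agree_mult agree_refl agree_finite_schur_q[OF x N])
    then show ?thesis by (simp add: agree_upto_def)
  qed
  finally show "mps_coeff (schur_Q x l) m = mps_coeff (pf_two_row (schur_q x) l) m" .
qed

section \<open>A Pfaffian as a sum over subsets\<close>

text \<open>
  Two copies \<open>Eta i\<close>, \<open>Xi i\<close> of the indices, coupled to each other. \<open>Eta_free i\<close> is \<open>Eta i\<close> with the coupling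
  removed, and \<open>Unit i\<close> carries nothing but the coupling, so that \<open>Eta i\<close> is the sum of the two.
\<close>

datatype symbol = Eta nat | Eta_free nat | Unit nat | Xi nat

text \<open>
  The matrix \<open>B\<close> is transposed because the symbols \<open>Xi\<close> are listed in reverse order.
\<close>

fun coupled_form :: "(nat \<Rightarrow> nat \<Rightarrow> 'a) \<Rightarrow> (nat \<Rightarrow> nat \<Rightarrow> 'a) \<Rightarrow> symbol \<Rightarrow> symbol \<Rightarrow> 'a :: comm_ring_1" where
  "coupled_form A B (Eta i) (Eta j) = A i j"
| "coupled_form A B (Eta i) (Eta_free j) = A i j"
| "coupled_form A B (Eta i) (Unit j) = 0"
| "coupled_form A B (Eta i) (Xi j) = (if i = j then 1 else 0)"
| "coupled_form A B (Eta_free i) (Eta j) = A i j"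
| "coupled_form A B (Eta_free i) (Eta_free j) = A i j"
| "coupled_form A B (Eta_free i) (Unit j) = 0"
| "coupled_form A B (Eta_free i) (Xi j) = 0"
| "coupled_form A B (Unit i) (Eta j) = 0"
| "coupled_form A B (Unit i) (Eta_free j) = 0"
| "coupled_form A B (Unit i) (Unit j) = 0"
| "coupled_form A B (Unit i) (Xi j) = (if i = j then 1 else 0)"
| "coupled_form A B (Xi i) (Eta j) = (if i = j then - 1 else 0)"
| "coupled_form A B (Xi i) (Eta_free j) = 0"
| "coupled_form A B (Xi i) (Unit j) = (if i = j then - 1 else 0)"
| "coupled_form A B (Xi i) (Xi j) = B j i"

lemma alternating_coupled_form:
  assumes "alternating_form A" "alternating_form B"
  shows "alternating_form (coupled_form A B)"
proof
  interpret A: alternating_form A by fact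
  interpret B: alternating_form B by fact
  show "coupled_form A B s t = - coupled_form A B t s" for s t
    by (cases s; cases t) (auto simp: A.skew[symmetric] B.skew[symmetric])
  show "coupled_form A B s s = 0" for s by (cases s) auto
qed

lemma sum_Pow_insert:
  assumes "finite A" "x \<notin> A"
  shows "(\<Sum>S\<in>Pow (insert x A). f S) = (\<Sum>S\<in>Pow A. f S) + (\<Sum>S\<in>Pow A. f (insert x S) :: 'a :: comm_monoid_add)"
proof -
  have "inj_on (insert x) (Pow A)"
  proof (rule inj_onI)
    fix S S' assume "S \<in> Pow A" "S' \<in> Pow A" "insert x S = insert x S'"
    then show "S = S'" using assms(2) by (metis PowD insert_ident subsetD)
  qed
  moreover have "Pow A \<inter> insert x ` Pow A = {}" using assms(2) by auto
  ultimately show ?thesis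
    using assms(1) by (simp add: Pow_insert sum.union_disjoint sum.reindex)
qed

text \<open>
  Each \<open>Eta d\<close> is written as \<open>Eta_free d\<close> plus \<open>Unit d\<close>, beginning with the innermost one. In the second
  case \<open>Unit d\<close> must be matched with \<open>Xi d\<close>, and both disappear; in the first case they stay, and
  \<open>d\<close> enters the set \<open>S\<close>. The nested order of the symbols makes all signs positive: the number of
  symbols between \<open>Eta d\<close> and \<open>Xi d\<close> is even at every stage.
\<close>

lemma pf_decouple:
  assumes "distinct ds" and "set ds \<inter> set is = {}"
  shows "pf (coupled_form A B) (map Eta ds @ map Eta_free is @ map Xi (rev is) @ map Xi (rev ds))
    = (\<Sum>S\<in>Pow (set ds). pf (coupled_form A B)
        (map Eta_free (filter (\<lambda>i. i \<in> S) ds @ is) @ map Xi (rev (filter (\<lambda>i. i \<in> S) ds @ is))))"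
  using assms
proof (induction ds arbitrary: "is" rule: rev_induct)
  case (snoc d ds)
  let ?C = "coupled_form A B"
  let ?as = "map Eta ds" and ?cs = "map Eta_free is @ map Xi (rev is)" and ?bs = "map Xi (rev ds)"
  let ?g = "\<lambda>S ds is. pf ?C (map Eta_free (filter (\<lambda>i. i \<in> S) ds @ is) @ map Xi (rev (filter (\<lambda>i. i \<in> S) ds @ is)))"
  have d: "d \<notin> set ds" "d \<notin> set is" using snoc.prems by auto
  have "pf ?C (?as @ Eta d # (?cs @ Xi d # ?bs))
      = (\<Sum>t\<in>UNIV. 1 * pf ?C (?as @ (if t then Eta_free d else Unit d) # (?cs @ Xi d # ?bs)))"
  proof (rule pf_linear)
    show "?C (Eta d) z = (\<Sum>t\<in>UNIV. 1 * ?C (if t then Eta_free d else Unit d) z)" for z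
      by (cases z) (auto simp: UNIV_bool)
    show "?C z (Eta d) = (\<Sum>t\<in>UNIV. 1 * ?C z (if t then Eta_free d else Unit d))" for z
      by (cases z) (auto simp: UNIV_bool)
  qed
  also have "\<dots> = pf ?C (?as @ Eta_free d # ?cs @ Xi d # ?bs) + pf ?C (?as @ Unit d # ?cs @ Xi d # ?bs)"
    by (simp add: UNIV_bool)
  also have "pf ?C (?as @ Unit d # ?cs @ Xi d # ?bs) = pf ?C (?as @ ?cs @ ?bs)"
  proof (subst pf_isolated)
    fix z assume "z \<in> set ?as \<union> set ?cs \<union> set ?bs"
    then show "?C (Unit d) z = 0 \<and> ?C z (Unit d) = 0" using d by auto
  qed simp
  also have "\<dots> = (\<Sum>S\<in>Pow (set ds). ?g S ds is)"
    using snoc.IH[of "is"] snoc.prems by simp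
  also have "pf ?C (?as @ Eta_free d # ?cs @ Xi d # ?bs) = (\<Sum>S\<in>Pow (set ds). ?g S ds (d # is))"
    using snoc.IH[of "d # is"] snoc.prems by simp
  also have "(\<Sum>S\<in>Pow (set ds). ?g S ds (d # is)) + (\<Sum>S\<in>Pow (set ds). ?g S ds is)
    = (\<Sum>S\<in>Pow (insert d (set ds)). ?g S (ds @ [d]) is)"
  proof -
    have with_d: "?g S ds (d # is) = ?g (insert d S) (ds @ [d]) is" if "S \<in> Pow (set ds)" for S
    proof -
      have "filter (\<lambda>i. i \<in> insert d S) ds = filter (\<lambda>i. i \<in> S) ds"
        using d by (intro filter_cong) auto
      then show ?thesis by simp
    qed
    have without_d: "?g S ds is = ?g S (ds @ [d]) is" if "S \<in> Pow (set ds)" for S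
      using d that by auto
    have "(\<Sum>S\<in>Pow (set ds). ?g S ds (d # is)) = (\<Sum>S\<in>Pow (set ds). ?g (insert d S) (ds @ [d]) is)"
      by (intro sum.cong refl with_d)
    moreover have "(\<Sum>S\<in>Pow (set ds). ?g S ds is) = (\<Sum>S\<in>Pow (set ds). ?g S (ds @ [d]) is)"
      by (intro sum.cong refl without_d)
    ultimately show ?thesis
      unfolding sum_Pow_insert[OF finite_set d(1)] by (simp only: add.commute)
  qed
  finally show ?case by simp
qed simp

theorem pf_coupled_form:
  assumes "alternating_form B" and "distinct ds"
  shows "pf (coupled_form A B) (map Eta ds @ map Xi (rev ds))
    = (\<Sum>S\<in>Pow (set ds). pf A (filter (\<lambda>i. i \<in> S) ds) * pf B (filter (\<lambda>i. i \<in> S) ds))"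
proof -
  have "pf (coupled_form A B) (map Eta_free J @ map Xi (rev J)) = pf A J * pf B J" for J
  proof -
    have "pf (coupled_form A B) (map Eta_free J @ map Xi (rev J))
        = pf (coupled_form A B) (map Eta_free J) * pf (coupled_form A B) (map Xi (rev J))"
      by (rule pf_append_orthogonal) auto
    also have "\<dots> = pf A J * pf (\<lambda>i j. B j i) (rev J)" by (simp add: pf_map del: rev_map)
    finally show ?thesis by (simp add: alternating_form.pf_transpose_rev[OF assms(1)])
  qed
  then show ?thesis using pf_decouple[OF assms(2), of "[]" A B] by simp
qed

section \<open>Power series with constant term 1\<close>

lemma mps_coeff_empty_mult: "mps_coeff (f * g) {#} = mps_coeff f {#} * mps_coeff g {#}"
  by (simp add: mps_coeff_mult splits_def)

lemma mps_coeff_power_eq_0: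
  "mps_coeff u {#} = 0 \<Longrightarrow> size m < k \<Longrightarrow> mps_coeff (u ^ k) m = 0"
proof (induction k arbitrary: m)
  case (Suc k)
  have "mps_coeff u a * mps_coeff (u ^ k) b = 0" if "(a, b) \<in> splits m" for a b
  proof (cases "a = {#}")
    case False
    then have "size b < size m" using that by (auto simp: splits_def nonempty_has_size)
    then show ?thesis using Suc by simp
  qed (use Suc in simp)
  then show ?case by (auto simp: mps_coeff_mult intro!: sum.neutral)
qed simp

text \<open>
  The inverse is the geometric series in \<open>1 - p\<close>, which contributes to a monomial of degree \<open>n\<close> only
  through its terms up to the exponent \<open>n\<close>.
\<close>

lemma mps_inverse_exists:
  assumes "mps_coeff p {#} = 1"
  obtains q where "p * q = 1"
proof
  let ?u = "1 - p"
  let ?S = "\<lambda>n. \<Sum>k\<le>n. ?u ^ k"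
  define q where "q = Abs_mps (\<lambda>m. mps_coeff (?S (size m)) m)"
  have u: "mps_coeff ?u {#} = 0" using assms by simp
  show "p * q = 1"
  proof (rule mps_eqI)
    fix m
    have "agree_upto m q (?S (size m))"
      unfolding agree_upto_def
    proof (intro allI impI)
      fix a assume "a \<subseteq># m"
      then have "size a \<le> size m" by (rule size_mset_mono)
      then have "mps_coeff (?S (size m)) a = mps_coeff (?S (size a)) a"
        unfolding mps_coeff_sum
        by (intro sum.mono_neutral_right) (auto intro!: mps_coeff_power_eq_0[OF u])
      then show "mps_coeff q a = mps_coeff (?S (size m)) a" by (simp add: q_def)
    qed
    then have "mps_coeff (p * q) m = mps_coeff (p * ?S (size m)) m"
      using agree_mult[OF agree_refl[of m p]] by (auto simp: agree_upto_def)
    also have "p * ?S n = 1 - ?u ^ Suc n" for n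
      by (induction n) (simp_all add: algebra_simps)
    finally show "mps_coeff (p * q) m = mps_coeff 1 m"
      using mps_coeff_power_eq_0[OF u, of m "Suc (size m)"] by simp
  qed
qed

section \<open>Determinants of block matrices\<close>

definition gram_det :: "('i \<Rightarrow> 'i \<Rightarrow> 'a :: comm_ring_1) \<Rightarrow> 'i list \<Rightarrow> 'a" where
  "gram_det M xs = det (mat (length xs) (length xs) (\<lambda>(i, j). M (xs ! i) (xs ! j)))"

text \<open>
  Rows and columns are permuted alike, so that the sign of the permutation enters twice.
\<close>

lemma gram_det_mset:
  assumes "mset xs = mset ys"
  shows "gram_det M xs = gram_det M ys"
proof -
  let ?n = "length ys"
  obtain p where p: "p permutes {..<?n}" and xs: "permute_list p ys = xs"
    using mset_eq_permutation[OF assms] by blast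
  have p0: "p permutes {0..<?n}" using p by (simp add: atLeast0LessThan)
  define A where "A = mat ?n ?n (\<lambda>(i, j). M (ys ! i) (ys ! j))"
  define B where "B = mat ?n ?n (\<lambda>(i, j). A $$ (p i, j))"
  have len: "length xs = ?n" using assms by (rule mset_eq_length)
  have pi: "p i < ?n" if "i < ?n" for i using permutes_in_image[OF p, of i] that by simp
  have "mat ?n ?n (\<lambda>(i, j). B\<^sup>T $$ (p i, j)) = (mat ?n ?n (\<lambda>(i, j). M (xs ! i) (xs ! j)))\<^sup>T"
    using pi by (intro eq_matI) (auto simp: A_def B_def permute_list_nth[OF p] simp flip: xs)
  then have "gram_det M xs = det (mat ?n ?n (\<lambda>(i, j). B\<^sup>T $$ (p i, j)))"
    unfolding gram_det_def len by (simp add: det_transpose[where n = ?n])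
  also have "\<dots> = signof p * det B\<^sup>T"
    by (rule det_permute_rows[OF _ p0]) (simp add: B_def)
  also have "det B\<^sup>T = det B" by (rule det_transpose[where n = ?n]) (simp add: B_def)
  also have "det B = signof p * det A"
    unfolding B_def by (rule det_permute_rows[OF _ p0]) (simp add: A_def)
  also have "signof p * (signof p * det A) = det A"
    by (simp add: sign_def)
  finally show ?thesis by (simp add: gram_det_def A_def)
qed

lemma det_four_block_one_left:
  fixes D :: "'a :: comm_ring_1 mat"
  assumes D: "D \<in> carrier_mat m m"
  shows "det (four_block_mat (1\<^sub>m n) (0\<^sub>m n m) (0\<^sub>m m n) D) = det D"
proof (induction n)
  case 0
  have "four_block_mat (1\<^sub>m 0) (0\<^sub>m 0 m) (0\<^sub>m m 0) D = D"
    using D by (intro eq_matI) auto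
  then show ?case by simp
next
  case (Suc n)
  let ?E = "four_block_mat (1\<^sub>m n) (0\<^sub>m n m) (0\<^sub>m m n) D"
  have E: "?E \<in> carrier_mat (n + m) (n + m)" using D by simp
  have "four_block_mat (1\<^sub>m (Suc n)) (0\<^sub>m (Suc n) m) (0\<^sub>m m (Suc n)) D
      = four_block_mat (1\<^sub>m 1) (0\<^sub>m 1 (n + m)) (0\<^sub>m (n + m) 1) ?E"
    using D by (intro eq_matI) auto
  also have "det \<dots> = det (1\<^sub>m 1 :: 'a mat) * det ?E"
    by (rule det_four_block_mat_lower_left_zero_col[OF _ _ _ E]) auto
  finally show ?case using Suc by simp
qed

lemma det_four_block_one_right:
  fixes A :: "'a :: comm_ring_1 mat"
  assumes A: "A \<in> carrier_mat n n"
  shows "det (four_block_mat A (0\<^sub>m n m) (0\<^sub>m m n) (1\<^sub>m m)) = det A"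
proof (induction m)
  case 0
  have "four_block_mat A (0\<^sub>m n 0) (0\<^sub>m 0 n) (1\<^sub>m 0) = A"
    using A by (intro eq_matI) auto
  then show ?case by simp
next
  case (Suc m)
  let ?E = "four_block_mat A (0\<^sub>m n m) (0\<^sub>m m n) (1\<^sub>m m)"
  have E: "?E \<in> carrier_mat (n + m) (n + m)" using A by simp
  have "four_block_mat A (0\<^sub>m n (Suc m)) (0\<^sub>m (Suc m) n) (1\<^sub>m (Suc m))
      = four_block_mat ?E (0\<^sub>m (n + m) 1) (0\<^sub>m 1 (n + m)) (1\<^sub>m 1)"
    using A by (intro eq_matI) auto
  also have "det \<dots> = det ?E * det (1\<^sub>m 1 :: 'a mat)"
    by (rule det_four_block_mat_upper_right_zero_col[OF E]) auto
  finally show ?case using Suc by simp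
qed

lemma det_four_block_unipotent:
  fixes B :: "'a :: comm_ring_1 mat"
  assumes B: "B \<in> carrier_mat n m"
  shows "det (four_block_mat (1\<^sub>m n) B (0\<^sub>m m n) (1\<^sub>m m)) = 1"
proof (subst det_upper_triangular[where n = "n + m"])
  let ?U = "four_block_mat (1\<^sub>m n) B (0\<^sub>m m n) (1\<^sub>m m)"
  show "upper_triangular ?U" using B by (auto simp: upper_triangular_def)
  show "?U \<in> carrier_mat (n + m) (n + m)" using B by simp
  have "diag_mat ?U = replicate (n + m) 1"
    using B by (intro nth_equalityI) (auto simp: diag_mat_def)
  then show "prod_list (diag_mat ?U) = 1" by simp
qed

text \<open>
  Over a commutative ring without further assumptions this follows from the factorization
  into \<open>diag(1, D)\<close>, a unipotent matrix and \<open>diag(A, 1)\<close>.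
\<close>

lemma det_block_upper:
  fixes A :: "'a :: comm_ring_1 mat"
  assumes A: "A \<in> carrier_mat n n" and B: "B \<in> carrier_mat n m" and D: "D \<in> carrier_mat m m"
  shows "det (four_block_mat A B (0\<^sub>m m n) D) = det A * det D"
proof -
  let ?L = "four_block_mat (1\<^sub>m n) (0\<^sub>m n m) (0\<^sub>m m n) D"
  let ?U = "four_block_mat (1\<^sub>m n) B (0\<^sub>m m n) (1\<^sub>m m)"
  let ?R = "four_block_mat A (0\<^sub>m n m) (0\<^sub>m m n) (1\<^sub>m m)"
  have UR: "?U * ?R = four_block_mat A B (0\<^sub>m m n) (1\<^sub>m m)"
    by (subst mult_four_block_mat[where ?n1.0 = n and ?n2.0 = m]) (use A B in auto)
  have "?L * (?U * ?R) = four_block_mat A B (0\<^sub>m m n) D"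
    unfolding UR by (subst mult_four_block_mat[where ?n1.0 = n and ?n2.0 = m]) (use A B D in auto)
  moreover have "det (?L * (?U * ?R)) = det ?L * (det ?U * det ?R)"
  proof -
    have "?L \<in> carrier_mat (n + m) (n + m)" "?U \<in> carrier_mat (n + m) (n + m)" "?R \<in> carrier_mat (n + m) (n + m)"
      using A B D by auto
    then show ?thesis by (metis det_mult mult_carrier_mat)
  qed
  ultimately show ?thesis
    by (simp add: det_four_block_one_left[OF D] det_four_block_one_right[OF A] det_four_block_unipotent[OF B] mult.commute)
qed

lemma det_block_lower:
  fixes A :: "'a :: comm_ring_1 mat"
  assumes A: "A \<in> carrier_mat n n" and C: "C \<in> carrier_mat m n" and D: "D \<in> carrier_mat m m"
  shows "det (four_block_mat A (0\<^sub>m n m) C D) = det A * det D"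
proof -
  let ?M = "four_block_mat A (0\<^sub>m n m) C D"
  have "det ?M = det ?M\<^sup>T" using A D by (simp add: det_transpose[where n = "n + m"])
  also have "?M\<^sup>T = four_block_mat A\<^sup>T C\<^sup>T (0\<^sub>m m n) D\<^sup>T"
    by (subst transpose_four_block_mat[OF A _ C D]) auto
  also have "det \<dots> = det A\<^sup>T * det D\<^sup>T" by (rule det_block_upper) (use A C D in auto)
  finally show ?thesis using A D by (simp add: det_transpose)
qed

section \<open>The square of a Pfaffian\<close>

lemma det_two_by_two_skew:
  "det (mat 2 2 (\<lambda>(i, j). if i = j then 0 else if i = 0 then p else - p)) = (p :: 'a :: comm_ring_1)\<^sup>2"
proof -
  let ?A = "mat 2 2 (\<lambda>(i, j). if i = j then 0 else if i = 0 then p else - p) :: 'a mat"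
  have "det ?A = (\<Sum>i<2. ?A $$ (i, 0) * cofactor ?A i 0)"
    by (rule laplace_expansion_column[where n = 2]) auto
  also have "\<dots> = - p * cofactor ?A 1 0"
    by (simp add: numeral_2_eq_2)
  also have "cofactor ?A 1 0 = - p"
    unfolding cofactor_def by (subst det_single) (auto simp: mat_delete_def)
  finally show ?thesis by (simp add: power2_eq_square)
qed

context alternating_form
begin

text \<open>
  The determinant undergoes the same elimination as the Pfaffian in \<open>pf_eliminate\<close>.
\<close>

lemma gram_det_eliminate:
  assumes q: "M u v * q = 1"
  shows "gram_det M (u # v # xs) = (M u v)\<^sup>2 * gram_det (eliminate u v q) xs"
proof -
  let ?m = "length xs" and ?p = "M u v"
  define P where "P = mat 2 2 (\<lambda>(i, j). if i = j then 0 else if i = 0 then ?p else - ?p)"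
  define B where "B = mat 2 ?m (\<lambda>(i, j). M (if i = 0 then u else v) (xs ! j))"
  define C where "C = mat ?m 2 (\<lambda>(i, j). M (xs ! i) (if j = 0 then u else v))"
  define D where "D = mat ?m ?m (\<lambda>(i, j). M (xs ! i) (xs ! j))"
  \<comment> \<open>X = - C * (inverse of P), the row operation that clears C.\<close>
  define X where "X = mat ?m 2 (\<lambda>(i, j). if j = 0 then - q * M (xs ! i) v else q * M (xs ! i) u)"
  define N where "N = mat ?m ?m (\<lambda>(i, j). eliminate u v q (xs ! i) (xs ! j))"
  note defs = P_def B_def C_def D_def X_def N_def
  have carriers: "P \<in> carrier_mat 2 2" "B \<in> carrier_mat 2 ?m" "C \<in> carrier_mat ?m 2" "D \<in> carrier_mat ?m ?m"
    "X \<in> carrier_mat ?m 2" "N \<in> carrier_mat ?m ?m"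
    by (simp_all add: defs)
  let ?L = "four_block_mat (1\<^sub>m 2) (0\<^sub>m 2 ?m) X (1\<^sub>m ?m)" and ?F = "four_block_mat P B C D"
  have "mat (length (u # v # xs)) (length (u # v # xs)) (\<lambda>(i, j). M ((u # v # xs) ! i) ((u # v # xs) ! j)) = ?F"
    by (intro eq_matI) (auto simp: defs skew[of v u] nth_Cons less_Suc_eq_0_disj numeral_2_eq_2 split: nat.splits)
  then have F: "gram_det M (u # v # xs) = det ?F" by (simp add: gram_det_def)
  have XP: "X * P + C = 0\<^sub>m ?m 2"
  proof (intro eq_matI)
    fix i j assume ij: "i < dim_row (0\<^sub>m ?m 2)" "j < dim_col (0\<^sub>m ?m 2)"
    then have "j = 0 \<or> j = 1" by auto
    have cancel: "q * (?p * a) = a" for a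
      using q by (metis mult.assoc mult.commute mult.right_neutral)
    with ij \<open>j = 0 \<or> j = 1\<close> show "(X * P + C) $$ (i, j) = 0\<^sub>m ?m 2 $$ (i, j)"
      by (auto simp: defs scalar_prod_def numeral_2_eq_2 ac_simps cancel)
  qed (simp_all add: defs)
  have XB: "X * B + D = N"
    by (intro eq_matI) (auto simp: defs scalar_prod_def numeral_2_eq_2 eliminate_def algebra_simps)
  have "?L * ?F = four_block_mat P B (0\<^sub>m ?m 2) N"
    by (subst mult_four_block_mat[where ?n1.0 = 2 and ?n2.0 = ?m]) (use carriers XP XB in auto)
  moreover have "det (?L * ?F) = det ?L * det ?F"
    using carriers by (intro det_mult[where n = "2 + ?m"]) auto
  moreover have "det ?L = 1"
    using det_block_lower[of "1\<^sub>m 2" 2 X ?m "1\<^sub>m ?m"] carriers by simp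
  moreover have "det (four_block_mat P B (0\<^sub>m ?m 2) N) = det P * det N"
    using carriers by (intro det_block_upper)
  moreover have "det P = ?p\<^sup>2"
    unfolding P_def by (rule det_two_by_two_skew)
  ultimately show ?thesis unfolding F by (simp add: gram_det_def N_def)
qed

end

text \<open>
  The square of the Pfaffian is the determinant whenever the constant term of the matrix is the
  standard symplectic one. Then the pivot \<open>M (f d) (g d)\<close> has constant term 1 and is a unit, and
  the elimination does not change the constant terms of the remaining entries.
\<close>

theorem pf_square:
  fixes M :: "'i \<Rightarrow> 'i \<Rightarrow> 'v mps"
  assumes "alternating_form M" and "distinct ds"
    and "\<And>i j. i \<in> set ds \<Longrightarrow> j \<in> set ds \<Longrightarrow> mps_coeff (M (f i) (f j)) {#} = 0"
    and "\<And>i j. i \<in> set ds \<Longrightarrow> j \<in> set ds \<Longrightarrow> mps_coeff (M (g i) (g j)) {#} = 0"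
    and "\<And>i j. i \<in> set ds \<Longrightarrow> j \<in> set ds \<Longrightarrow> mps_coeff (M (f i) (g j)) {#} = (if i = j then 1 else 0)"
  shows "(pf M (map f ds @ map g (rev ds)))\<^sup>2 = gram_det M (map f ds @ map g (rev ds))
    \<and> mps_coeff (pf M (map f ds @ map g (rev ds))) {#} = 1"
  using assms
proof (induction ds arbitrary: M)
  case Nil
  then show ?case by (simp add: gram_det_def)
next
  case (Cons d ds)
  interpret alternating_form M by fact
  let ?u = "f d" and ?v = "g d" and ?xs = "map f ds @ map g (rev ds)"
  have p: "mps_coeff (M ?u ?v) {#} = 1" using Cons.prems(5)[of d d] by simp
  obtain q where q: "M ?u ?v * q = 1" using mps_inverse_exists[OF p] by blast
  let ?N = "eliminate ?u ?v q"
  have d: "d \<notin> set ds" using Cons.prems(2) by simp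
  have gf: "mps_coeff (M (g i) (f j)) {#} = (if i = j then - 1 else 0)"
    if "i \<in> set (d # ds)" "j \<in> set (d # ds)" for i j
    using Cons.prems(5)[of j i] that by (simp add: skew[of "g i" "f j"])
  have N: "mps_coeff (?N a b) {#} = mps_coeff (M a b) {#}"
    if "a \<in> f ` set ds \<union> g ` set ds" "b \<in> f ` set ds \<union> g ` set ds" for a b
    using that d
    by (auto simp: eliminate_def mps_coeff_empty_mult gf Cons.prems(3,4,5) split: if_splits)
  have IH: "(pf ?N ?xs)\<^sup>2 = gram_det ?N ?xs \<and> mps_coeff (pf ?N ?xs) {#} = 1"
    using Cons.prems by (intro Cons.IH alternating_eliminate) (auto simp: N)
  have list: "map f (d # ds) @ map g (rev (d # ds)) = ?u # ?xs @ [?v]" by simp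
  have "pf M (?u # ?xs @ [?v]) = M ?u ?v * pf ?N ?xs"
    by (rule pf_eliminate[OF q]) simp
  moreover have "gram_det M (?u # ?xs @ [?v]) = (M ?u ?v)\<^sup>2 * gram_det ?N ?xs"
    using gram_det_mset[of "?u # ?xs @ [?v]" "?u # ?v # ?xs" M] gram_det_eliminate[OF q] by simp
  ultimately show ?case
    unfolding list using IH p by (simp add: power_mult_distrib mps_coeff_empty_mult)
qed

text \<open>
  The factorization is the block form of writing a quarter turn as a product of three shears.
\<close>

lemma det_antidiagonal_block: 
  "det (four_block_mat (0\<^sub>m n n) (- (1\<^sub>m n)) (1\<^sub>m n) (0\<^sub>m n n) :: 'a :: comm_ring_1 mat) = 1"
proof -
  let ?U = "four_block_mat (1\<^sub>m n) (- (1\<^sub>m n)) (0\<^sub>m n n) (1\<^sub>m n) :: 'a mat"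
  let ?L = "four_block_mat (1\<^sub>m n) (0\<^sub>m n n) (1\<^sub>m n) (1\<^sub>m n) :: 'a mat"
  have [simp]: "- (1\<^sub>m n) + 1\<^sub>m n = (0\<^sub>m n n :: 'a mat)" "1\<^sub>m n + - (1\<^sub>m n) = (0\<^sub>m n n :: 'a mat)"
    by (intro eq_matI; simp)+
  have LU: "?L * ?U = four_block_mat (1\<^sub>m n) (- (1\<^sub>m n)) (1\<^sub>m n) (0\<^sub>m n n)"
    by (subst mult_four_block_mat[where ?n1.0 = n and ?n2.0 = n]) auto
  have "?U * (?L * ?U) = four_block_mat (0\<^sub>m n n) (- (1\<^sub>m n)) (1\<^sub>m n) (0\<^sub>m n n)"
    unfolding LU by (subst mult_four_block_mat[where ?n1.0 = n and ?n2.0 = n]) auto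
  moreover have "det (?U * (?L * ?U)) = det ?U * (det ?L * det ?U)"
  proof -
    have "?U \<in> carrier_mat (n + n) (n + n)" "?L \<in> carrier_mat (n + n) (n + n)" by auto
    then show ?thesis by (metis det_mult mult_carrier_mat)
  qed
  moreover have "det ?U = 1" "det ?L = 1"
    using det_four_block_unipotent[of "- (1\<^sub>m n)" n n] det_block_lower[of "1\<^sub>m n" n "1\<^sub>m n" n "1\<^sub>m n"] by auto
  ultimately show ?thesis by simp
qed

text \<open>
  A row operation clears the upper left block and turns the upper right one into \<open>1 - A B\<close>.
\<close>

lemma det_four_block_coupling:
  fixes A :: "'a :: comm_ring_1 mat"
  assumes A: "A \<in> carrier_mat n n" and B: "B \<in> carrier_mat n n"
  shows "det (four_block_mat A (1\<^sub>m n) (- (1\<^sub>m n)) (- B)) = det (1\<^sub>m n - A * B)"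
proof -
  let ?F = "four_block_mat A (1\<^sub>m n) (- (1\<^sub>m n)) (- B)"
  let ?U = "four_block_mat (1\<^sub>m n) A (0\<^sub>m n n) (1\<^sub>m n)"
  let ?J = "four_block_mat (0\<^sub>m n n) (- (1\<^sub>m n)) (1\<^sub>m n) (0\<^sub>m n n) :: 'a mat"
  have A0: "A + A * (- 1\<^sub>m n) = 0\<^sub>m n n" using A by (intro eq_matI) auto
  have AB: "1\<^sub>m n + A * (- B) = 1\<^sub>m n - A * B" using A B by (intro eq_matI) auto
  have UF: "?U * ?F = four_block_mat (0\<^sub>m n n) (1\<^sub>m n - A * B) (- (1\<^sub>m n)) (- B)"
    by (subst mult_four_block_mat[where ?n1.0 = n and ?n2.0 = n]) (use A B A0 AB in auto)
  have one: "(- 1\<^sub>m n) * (- 1\<^sub>m n) = (1\<^sub>m n :: 'a mat)"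
    by (intro eq_matI) auto
  have UFJ: "(?U * ?F) * ?J = four_block_mat (1\<^sub>m n - A * B) (0\<^sub>m n n) (- B) (1\<^sub>m n)"
    unfolding UF by (subst mult_four_block_mat[where ?n1.0 = n and ?n2.0 = n]) (use A B one in auto)
  have "det ((?U * ?F) * ?J) = det ?U * det ?F * det ?J"
  proof -
    have "?U \<in> carrier_mat (n + n) (n + n)" "?F \<in> carrier_mat (n + n) (n + n)" "?J \<in> carrier_mat (n + n) (n + n)"
      using A B by auto
    then show ?thesis by (metis det_mult mult_carrier_mat)
  qed
  moreover have "det ?U = 1" by (rule det_four_block_unipotent[OF A])
  moreover have "det ?J = 1" by (rule det_antidiagonal_block)
  moreover have "det ((?U * ?F) * ?J) = det (1\<^sub>m n - A * B)"
    unfolding UFJ using A B by (subst det_block_lower[where n = n and m = n]) auto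
  ultimately show ?thesis by simp
qed

lemma gram_det_coupled_form:
  assumes "alternating_form B"
  shows "gram_det (coupled_form A B) (map Eta [0..<n] @ map Xi (rev [0..<n]))
    = det (1\<^sub>m n - mat n n (\<lambda>(i, j). A i j) * mat n n (\<lambda>(i, j). B i j))"
proof -
  interpret B: alternating_form B by fact
  let ?xs = "map Eta [0..<n] @ map Xi [0..<n]"
  let ?A = "mat n n (\<lambda>(i, j). A i j)" and ?B = "mat n n (\<lambda>(i, j). B i j)"
  have "mat (length ?xs) (length ?xs) (\<lambda>(i, j). coupled_form A B (?xs ! i) (?xs ! j))
      = four_block_mat ?A (1\<^sub>m n) (- (1\<^sub>m n)) (- ?B)"
    by (intro eq_matI) (auto simp: nth_append B.skew[symmetric])
  then have "gram_det (coupled_form A B) ?xs = det (1\<^sub>m n - ?A * ?B)"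
    unfolding gram_det_def by (simp add: det_four_block_coupling[where n = n])
  moreover have "gram_det (coupled_form A B) (map Eta [0..<n] @ map Xi (rev [0..<n])) = gram_det (coupled_form A B) ?xs"
    by (rule gram_det_mset) (simp add: rev_map)
  ultimately show ?thesis by simp
qed

section \<open>The matrices K\<close>

lemma schur_q_0: "schur_q x 0 = 1"
proof (rule mps_eqI)
  fix m
  have "fps_nth (\<Prod>i<n. q_factor (x i)) 0 = 1" for n
    by (induction n) (simp_all add: q_factor_nth)
  then show "mps_coeff (schur_q x 0) m = mps_coeff 1 m"
    by (simp add: schur_q_def)
qed

lemma mps_coeff_schur_q_empty:
  "inj x \<Longrightarrow> mps_coeff (schur_q x k) {#} = (if k = 0 then 1 else 0)"
  using agree_finite_schur_q[of x "{#}" 0 k] by (auto simp: agree_upto_def finite_schur_q_def split: if_splits)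

lemma two_row_Q_eq: "s < r \<Longrightarrow> two_row_Q x r s = two_row (schur_q x) r s"
  unfolding two_row_Q_def two_row_mix_def Let_def atMost_atLeast0
  by (simp add: sum.atLeast_Suc_atMost sum_distrib_left mult.assoc)

lemma two_row_Q_skew: "two_row_Q x r s = - two_row_Q x s r"
  by (auto simp: two_row_Q_def Let_def)

definition K_entry :: "(nat \<Rightarrow> 'v) \<Rightarrow> nat \<Rightarrow> nat \<Rightarrow> 'v mps" where
  "K_entry x r s = (if r = 0 \<and> s = 0 then 0
     else if r = 0 then - mps_const (1 / sqrt 2) * schur_q x s
     else if s = 0 then mps_const (1 / sqrt 2) * schur_q x r
     else mps_const (1 / 2) * two_row_Q x r s)"

lemma K_mat_eq: "K_mat h x = mat (h + 1) (h + 1) (\<lambda>(r, s). K_entry x r s)"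
  by (simp add: K_mat_def K_entry_def)

lemma alternating_K_entry: "alternating_form (K_entry x)"
proof
  show "K_entry x r s = - K_entry x s r" for r s
    using two_row_Q_skew[of x r s] by (auto simp: K_entry_def)
  show "K_entry x r r = 0" for r by (simp add: K_entry_def two_row_Q_def)
qed

lemma mps_const_mult: "mps_const a * mps_const b = mps_const (a * b)"
proof (rule mps_eqI)
  fix m
  have "mps_coeff (mps_const a * mps_const b) m = (\<Sum>p\<in>splits m. if p = ({#}, {#}) then a * b else 0)"
    unfolding mps_coeff_mult by (intro sum.cong) (auto simp: mps_const_def split: if_splits)
  also have "\<dots> = (if ({#}, {#}) \<in> splits m then a * b else 0)" by simp
  finally show "mps_coeff (mps_const a * mps_const b) m = mps_coeff (mps_const (a * b)) m"
    by (auto simp: mps_const_def splits_def)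
qed

lemma mps_const_1: "mps_const 1 = 1"
  by (rule mps_eqI) (simp add: mps_const_def)

lemma mps_const_power: "mps_const a ^ n = mps_const (a ^ n)"
  by (induction n) (simp_all add: mps_const_1 mps_const_mult)

text \<open>
  The normalizations \<open>1/2\<close> and \<open>1 / sqrt 2\<close> in the entries of \<open>K\<close> arise from \<open>Q\<^sub>(\<^sub>r\<^sub>,\<^sub>s\<^sub>)\<close> by scaling
  row and column \<open>r\<close>, for each \<open>r > 0\<close>, by \<open>1 / sqrt 2\<close>.
\<close>

definition row_scale :: "nat \<Rightarrow> 'v mps" where
  "row_scale r = (if r = 0 then 1 else mps_const (1 / sqrt 2))"

lemma K_entry_below_diagonal:
  "s < r \<Longrightarrow> K_entry x r s = row_scale r * row_scale s * two_row (schur_q x) r s"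
proof -
  assume "s < r"
  have "mps_const (1 / sqrt 2) * mps_const (1 / sqrt 2) = (mps_const (1 / 2) :: 'a mps)"
    by (simp add: mps_const_mult)
  then show ?thesis
    using \<open>s < r\<close> by (auto simp: K_entry_def row_scale_def two_row_Q_eq two_row_mix_def schur_q_0)
qed

lemma mps_coeff_K_entry_empty:
  assumes "inj x"
  shows "mps_coeff (K_entry x r s) {#} = 0"
proof -
  have *: "mps_coeff (K_entry x r s) {#} = 0" if "s < r" for r s
    using that assms
    by (simp add: K_entry_below_diagonal mps_coeff_empty_mult two_row_mix_def mps_coeff_schur_q_empty)
  consider "s < r" | "r < s" | "r = s" by linarith
  then show ?thesis
  proof cases
    case 2
    then show ?thesis using *[of r s] alternating_form.skew[OF alternating_K_entry, of x r s] by simp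
  qed (simp_all add: * alternating_form.diag[OF alternating_K_entry])
qed

lemma pf_K_entry:
  assumes "strict_partition l"
  shows "pf (K_entry x) (pad l) = mps_const ((1 / sqrt 2) ^ length l) * pf_two_row (schur_q x) l"
proof -
  have "pf (K_entry x) (pad l) = pf (\<lambda>r s. row_scale r * row_scale s * two_row (schur_q x) r s) (pad l)"
    by (rule pf_cong, rule sorted_wrt_mono_rel[OF _ sorted_pad[OF assms]]) (rule K_entry_below_diagonal)
  also have "\<dots> = prod_list (map row_scale (pad l)) * pf_two_row (schur_q x) l"
    unfolding pf_scale pf_two_row_def ..
  also have "prod_list (map row_scale (pad l)) = (prod_list (map row_scale l) :: 'a mps)"
    by (simp add: pad_def row_scale_def)
  also have "prod_list (map row_scale l) = (mps_const ((1 / sqrt 2) ^ length l) :: 'a mps)"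
    using assms unfolding strict_partition_def mps_const_power[symmetric]
    by (induction l) (auto simp: row_scale_def)
  finally show ?thesis .
qed

text \<open>
  For each \<open>l\<close> exactly one of the two lists has even length, namely \<open>pad l\<close>. In its two Pfaffians
  every positive part contributes a factor \<open>1 / sqrt 2\<close>, which together give the
  \<open>2\<^sup>-\<^sup>\<ell>\<close>, \<open>\<ell> = length l\<close>, that distinguishes \<open>P\<close> from \<open>Q\<close>.
\<close>

lemma pf_K_entry_pair:
  assumes "strict_partition l" "inj x" "inj y"
  shows "pf (K_entry x) l * pf (K_entry y) l + pf (K_entry x) (l @ [0]) * pf (K_entry y) (l @ [0])
    = schur_Q x l * schur_P y l"
proof -
  let ?n = "length l"
  have "pf (K_entry x) l * pf (K_entry y) l + pf (K_entry x) (l @ [0]) * pf (K_entry y) (l @ [0])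
      = pf (K_entry x) (pad l) * pf (K_entry y) (pad l)"
    by (simp add: pad_def pf_odd)
  also have "\<dots> = mps_const ((1 / sqrt 2) ^ ?n) * mps_const ((1 / sqrt 2) ^ ?n)
      * (schur_Q x l * schur_Q y l)"
    using assms by (simp add: pf_K_entry schur_Q_eq_pf ac_simps)
  also have "mps_const ((1 / sqrt 2) ^ ?n) * mps_const ((1 / sqrt 2) ^ ?n) = (mps_const (1 / 2 ^ ?n) :: 'a mps)"
    by (simp add: mps_const_mult power_divide flip: power_mult_distrib)
  finally show ?thesis by (simp add: schur_P_def ac_simps)
qed

lemma strict_partition_filter: "strict_partition (filter (\<lambda>i. i \<in> S) (rev [1..<Suc h]))"
proof -
  have "sorted_wrt (>) (rev [1..<Suc h])" by (simp add: sorted_wrt_rev del: upt_Suc)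
  then show ?thesis
    unfolding strict_partition_def by (auto intro: sorted_wrt_filter)
qed

lemma sum_strict_partitions:
  "(\<Sum>l | strict_partition l \<and> largest_part l \<le> h. f l)
    = (\<Sum>S\<in>Pow {1..h}. f (filter (\<lambda>i. i \<in> S) (rev [1..<Suc h])))"
proof (rule sum.reindex_bij_witness[where i = "\<lambda>S. filter (\<lambda>i. i \<in> S) (rev [1..<Suc h])" and j = set])
  fix l assume "l \<in> {l. strict_partition l \<and> largest_part l \<le> h}"
  then have l: "strict_partition l" "largest_part l \<le> h" by auto
  show S: "set l \<in> Pow {1..h}"
    using l by (cases l) (auto simp: strict_partition_def largest_part_def Suc_le_eq)
  let ?l = "filter (\<lambda>i. i \<in> set l) (rev [1..<Suc h])"
  have "sorted_wrt (<) (rev ?l)" "sorted_wrt (<) (rev l)"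
    using l strict_partition_filter[of "set l" h] unfolding strict_partition_def sorted_wrt_rev by auto
  moreover have "set (rev ?l) = set (rev l)" using S by auto
  ultimately have "rev ?l = rev l" by (metis strict_sorted_equal)
  then show eq: "?l = l" by simp
  show "f ?l = f l" by (simp only: eq)
next
  fix S assume S: "S \<in> Pow {1..h}"
  let ?l = "filter (\<lambda>i. i \<in> S) (rev [1..<Suc h])"
  show "set ?l = S" using S by auto
  have "largest_part l \<le> h" if "\<forall>k\<in>set l. k \<le> h" for l
    using that by (cases l) (auto simp: largest_part_def)
  then have "largest_part ?l \<le> h" by auto
  then show "?l \<in> {l. strict_partition l \<and> largest_part l \<le> h}"
    using strict_partition_filter by blast
qed

theorem mainTheorem2:
  fixes h :: nat
  assumes "h \<ge> 1"
  shows "(\<Sum>l | strict_partition l \<and> largest_part l \<le> h. schur_Q x_vars l * schur_P y_vars l)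
    = mps_sqrt (det (1\<^sub>m (h + 1) - K_mat h x_vars * K_mat h y_vars))"
proof -
  let ?A = "K_entry x_vars" and ?B = "K_entry y_vars" and ?ds = "rev [0..<h + 1]"
  let ?C = "coupled_form ?A ?B"
  let ?xs = "map Eta ?ds @ map Xi (rev ?ds)"
  let ?t = "\<lambda>l. pf ?A l * pf ?B l"
  have inj: "inj x_vars" "inj y_vars" by simp_all
  note alt = alternating_K_entry[of x_vars] alternating_K_entry[of y_vars]
  have ds: "?ds = rev [1..<Suc h] @ [0]" by (simp add: upt_conv_Cons del: upt_Suc)
  have "pf ?C ?xs = (\<Sum>S\<in>Pow (set ?ds). ?t (filter (\<lambda>i. i \<in> S) ?ds))"
    by (rule pf_coupled_form[OF alt(2)]) simp
  also have "set ?ds = insert 0 {1..h}" by auto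
  also have "(\<Sum>S\<in>Pow (insert 0 {1..h}). ?t (filter (\<lambda>i. i \<in> S) ?ds))
      = (\<Sum>S\<in>Pow {1..h}. ?t (filter (\<lambda>i. i \<in> S) ?ds) + ?t (filter (\<lambda>i. i \<in> insert 0 S) ?ds))"
    by (subst sum_Pow_insert) (simp_all add: sum.distrib)
  also have "\<dots> = (\<Sum>S\<in>Pow {1..h}. schur_Q x_vars (filter (\<lambda>i. i \<in> S) (rev [1..<Suc h]))
      * schur_P y_vars (filter (\<lambda>i. i \<in> S) (rev [1..<Suc h])))"
  proof (rule sum.cong[OF refl])
    fix S assume "S \<in> Pow {1..h}"
    then have "0 \<notin> S" by auto
    let ?l = "filter (\<lambda>i. i \<in> S) (rev [1..<Suc h])"
    have "filter (\<lambda>i. i \<in> S) ?ds = ?l" unfolding ds using \<open>0 \<notin> S\<close> by simp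
    moreover have "filter (\<lambda>i. i \<in> insert 0 S) ?ds = ?l @ [0]"
    proof -
      have "filter (\<lambda>i. i \<in> insert 0 S) (rev [1..<Suc h]) = ?l" by (rule filter_cong) auto
      then show ?thesis unfolding ds filter_append by simp
    qed
    ultimately show "?t (filter (\<lambda>i. i \<in> S) ?ds) + ?t (filter (\<lambda>i. i \<in> insert 0 S) ?ds)
        = schur_Q x_vars ?l * schur_P y_vars ?l"
      by (simp only: pf_K_entry_pair[OF strict_partition_filter inj])
  qed
  also have "\<dots> = (\<Sum>l | strict_partition l \<and> largest_part l \<le> h. schur_Q x_vars l * schur_P y_vars l)"
    by (rule sum_strict_partitions[symmetric])
  finally have sum: "pf ?C ?xs = \<dots>" .
  have "(pf ?C ?xs)\<^sup>2 = gram_det ?C ?xs \<and> mps_coeff (pf ?C ?xs) {#} = 1"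
    by (rule pf_square[OF alternating_coupled_form[OF alt]])
       (auto simp: mps_coeff_K_entry_empty inj)
  moreover have "gram_det ?C ?xs = gram_det ?C (map Eta [0..<h + 1] @ map Xi (rev [0..<h + 1]))"
    by (rule gram_det_mset) (simp add: rev_map)
  moreover have "\<dots> = det (1\<^sub>m (h + 1) - K_mat h x_vars * K_mat h y_vars)"
    unfolding K_mat_eq by (rule gram_det_coupled_form[OF alt(2)])
  ultimately show ?thesis unfolding sum by (intro mps_sqrtI[symmetric]) auto
qed

end
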